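(* Let $A$ be an abelian variety and let $x_1,\ldots,x_k$ be $k$ points of $A$ ($k\ge 1$) such that $\sum_{i=1}^k\{x_i\}-k\{0_A\}=0$ in ${\rm CH}_0(A)$. Then for any $i=1,\ldots,k$, $$(\{x_i\}-\{0_A\})^{*k}=0\quad\text{in } {\rm CH}_0(A).$$
   Context: All varieties are over $\mathbb{C}$, and ${\rm CH}(A)$ denotes Chow groups with $\mathbb{Q}$-coefficients. $\{x\}$ is the $0$-cycle of a point $x\in A$ and $0_A$ is the origin. The Pontryagin product on ${\rm CH}(A)$ is $z*z'=\mu_*(pr_1^*z\cdot pr_2^*z')$, where $\mu:A\times A\to A$ is the sum map, and $z^{*k}$ denotes the $k$-th power for $*$. *)

theory Defs
  imports Complex_Main
    "HOL-Algebra.Ideal"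
    "HOL-Library.Poly_Mapping"
    "HOL-Library.Nat_Bijection"
    "HOL-Library.Extended_Nat"
begin

section \<open>Projective varieties over the complex numbers\<close>

text \<open>
  Classical projective geometry over the complex numbers. All projective spaces are nested in one
  another: homogeneous coordinates are functions on \<open>nat\<close>, and those of \<open>proj_space n\<close> are supported
  in \<open>{0..n}\<close>. A point is the set of all its homogeneous coordinate vectors (a line without the
  origin), so a condition on a point \<open>p\<close> is a condition on all \<open>v \<in> p\<close>.
\<close>

type_synonym point = "(nat \<Rightarrow> complex) set"

definition proj_point :: "(nat \<Rightarrow> complex) \<Rightarrow> point" where
  "proj_point v = {\<lambda>i. c * v i |c. c \<noteq> 0}"

definition proj_space :: "nat \<Rightarrow> point set" where
  "proj_space n = {proj_point v |v. v \<noteq> (\<lambda>_. 0) \<and> (\<forall>i>n. v i = 0)}"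

text \<open>Homogeneous polynomials of degree \<open>d\<close> in finitely many coordinates; since the field is
  infinite, they are identified with the functions they define.\<close>

inductive form :: "nat \<Rightarrow> ((nat \<Rightarrow> complex) \<Rightarrow> complex) \<Rightarrow> bool" where
  const: "form 0 (\<lambda>_. c)"
| coord: "form 1 (\<lambda>v. v i)"
| add: "form d F \<Longrightarrow> form d G \<Longrightarrow> form d (\<lambda>v. F v + G v)"
| mult: "form d F \<Longrightarrow> form e G \<Longrightarrow> form (d + e) (\<lambda>v. F v * G v)"

definition algebraic_set :: "point set \<Rightarrow> bool" where
  "algebraic_set Z \<longleftrightarrow> (\<exists>n S. (\<forall>F\<in>S. \<exists>d. form d F) \<and>
     Z = {p \<in> proj_space n. \<forall>F\<in>S. \<forall>v\<in>p. F v = 0})"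

definition variety :: "point set \<Rightarrow> bool" where
  "variety X \<longleftrightarrow> algebraic_set X \<and> X \<noteq> {} \<and>
     (\<forall>Y Z. algebraic_set Y \<longrightarrow> algebraic_set Z \<longrightarrow> X = Y \<union> Z \<longrightarrow> X = Y \<or> X = Z)"

text \<open>The supremum of the lengths \<open>l\<close> of chains \<open>J 0 \<subset> \<dots> \<subset> J l\<close> of sets satisfying \<open>P\<close>. It gives
  both the Krull dimension of a variety and the length of a module.\<close>

definition chain_length :: "('a set \<Rightarrow> bool) \<Rightarrow> enat" where
  "chain_length P =
     Sup {enat l |l. \<exists>J. (\<forall>i\<le>l. P (J i)) \<and> (\<forall>i<l. J i \<subset> J (Suc i))}"

definition krull_dim :: "point set \<Rightarrow> enat" where
  "krull_dim X = chain_length (\<lambda>Y. variety Y \<and> Y \<subseteq> X)"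

text \<open>Near every point of \<open>X\<close> a morphism is given by forms \<open>F 0, F 1, \<dots>\<close> of one and the same degree
  without common zero at that point. The formula may be required wherever the forms have no common
  zero: multiply them by a form that vanishes off a given neighbourhood.\<close>

definition morphism :: "point set \<Rightarrow> point set \<Rightarrow> (point \<Rightarrow> point) \<Rightarrow> bool" where
  "morphism X Y f \<longleftrightarrow> f \<in> X \<rightarrow> Y \<and>
     (\<forall>p\<in>X. \<exists>d F. (\<forall>i. form d (F i)) \<and> (\<forall>v\<in>p. \<exists>i. F i v \<noteq> 0) \<and>
        (\<forall>q\<in>X. \<forall>v\<in>q. (\<exists>i. F i v \<noteq> 0) \<longrightarrow> f q = proj_point (\<lambda>i. F i v)))"


subsection \<open>Products (Segre embedding)\<close>

definition segre :: "point \<Rightarrow> point \<Rightarrow> point" where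
  "segre p q = {\<lambda>k. v (fst (prod_decode k)) * w (snd (prod_decode k)) |v w. v \<in> p \<and> w \<in> q}"

definition prod_var :: "point set \<Rightarrow> point set \<Rightarrow> point set" (infixr "\<times>\<^sub>v" 80) where
  "X \<times>\<^sub>v Y = (\<lambda>(p, q). segre p q) ` (X \<times> Y)"

definition pr1 :: "point set \<Rightarrow> point set \<Rightarrow> point \<Rightarrow> point" where
  "pr1 X Y r = fst (inv_into (X \<times> Y) (\<lambda>(p, q). segre p q) r)"

definition pr2 :: "point set \<Rightarrow> point set \<Rightarrow> point \<Rightarrow> point" where
  "pr2 X Y r = snd (inv_into (X \<times> Y) (\<lambda>(p, q). segre p q) r)"


subsection \<open>Local rings\<close>

definition regular_at :: "point set \<Rightarrow> point \<Rightarrow> (point \<Rightarrow> complex) \<Rightarrow> bool" where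
  "regular_at X p f \<longleftrightarrow> (\<exists>d F G. form d F \<and> form d G \<and> (\<forall>v\<in>p. G v \<noteq> 0) \<and>
     (\<forall>q\<in>X. \<forall>v\<in>q. G v \<noteq> 0 \<longrightarrow> f q = F v / G v))"

text \<open>
  The ring of functions regular at \<open>p\<close>, before passing to germs. The local ring of \<open>X\<close> at \<open>p\<close> is its
  quotient by the ideal \<open>vanishing_at X p X\<close> of functions vanishing on \<open>X\<close> near \<open>p\<close>. Hence ideals of
  the local ring are ideals of \<open>reg_ring X p\<close> that contain \<open>vanishing_at X p X\<close>; we work with these
  preimages throughout. In this sense \<open>vanishing_at X p V\<close> is the ideal of \<open>V\<close> in the local ring, and
  \<open>vanishing_at X p {p}\<close> is the maximal ideal.
\<close>

definition reg_ring :: "point set \<Rightarrow> point \<Rightarrow> (point \<Rightarrow> complex) ring" where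
  "reg_ring X p = \<lparr>carrier = {f. regular_at X p f},
     mult = (\<lambda>f g q. f q * g q), one = (\<lambda>_. 1),
     zero = (\<lambda>_. 0), add = (\<lambda>f g q. f q + g q)\<rparr>"

definition vanishing_at :: "point set \<Rightarrow> point \<Rightarrow> point set \<Rightarrow> (point \<Rightarrow> complex) set" where
  "vanishing_at X p V = {f. regular_at X p f \<and>
     (\<exists>d G. form d G \<and> (\<forall>v\<in>p. G v \<noteq> 0) \<and> (\<forall>q\<in>V. \<forall>v\<in>q. G v \<noteq> 0 \<longrightarrow> f q = 0))}"

text \<open>The length of the quotient of the local ring of \<open>X\<close> at \<open>p\<close> by the ideal generated by \<open>S\<close>.\<close>

definition local_length :: "point set \<Rightarrow> point \<Rightarrow> (point \<Rightarrow> complex) set \<Rightarrow> enat" where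
  "local_length X p S =
     chain_length (\<lambda>J. ideal J (reg_ring X p) \<and> vanishing_at X p X \<subseteq> J \<and> S \<subseteq> J)"

text \<open>A curve is smooth if its local rings are regular, that is, if their maximal ideals are
  principal.\<close>

definition smooth_curve :: "point set \<Rightarrow> bool" where
  "smooth_curve C \<longleftrightarrow> variety C \<and> krull_dim C = 1 \<and>
     (\<forall>p\<in>C. \<exists>t. regular_at C p t \<and>
        vanishing_at C p {p} = genideal (reg_ring C p) (insert t (vanishing_at C p C)))"


section \<open>Zero-cycles and rational equivalence\<close>

text \<open>Zero-cycles with rational coefficients are finitely supported functions.\<close>

type_synonym cycle0 = "point \<Rightarrow>\<^sub>0 rat"

definition pt :: "point \<Rightarrow> cycle0" where
  "pt x = Poly_Mapping.single x 1"

definition scale :: "rat \<Rightarrow> cycle0 \<Rightarrow> cycle0" where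
  "scale c z = Poly_Mapping.map ((*) c) z"

definition pushforward :: "(point \<Rightarrow> point) \<Rightarrow> cycle0 \<Rightarrow> cycle0" where
  "pushforward f z = (\<Sum>x\<in>Poly_Mapping.keys z. Poly_Mapping.single (f x) (Poly_Mapping.lookup z x))"

text \<open>Local equations at \<open>p\<close> of the hypersurface section of \<open>X\<close> defined by a form \<open>F\<close> of degree \<open>d\<close>;
  any two of them differ by a unit of the local ring.\<close>

definition local_eqs ::
  "point set \<Rightarrow> point \<Rightarrow> nat \<Rightarrow> ((nat \<Rightarrow> complex) \<Rightarrow> complex) \<Rightarrow> (point \<Rightarrow> complex) set" where
  "local_eqs X p d F = {h. \<exists>H. form d H \<and> (\<forall>v\<in>p. H v \<noteq> 0) \<and>
     (\<forall>q\<in>X. \<forall>v\<in>q. H v \<noteq> 0 \<longrightarrow> h q = F v / H v)}"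

text \<open>The divisor of the nonzero rational function \<open>F / G\<close> on \<open>C\<close>. Its order at \<open>p\<close> is
  \<open>length (O / (a)) - length (O / (b))\<close> for any presentation of the function as \<open>a / b\<close> with \<open>a\<close> and
  \<open>b\<close> in the local ring \<open>O\<close> at \<open>p\<close>; here \<open>a = F / H\<close> and \<open>b = G / H\<close>.\<close>

definition is_principal :: "point set \<Rightarrow> cycle0 \<Rightarrow> bool" where
  "is_principal C z \<longleftrightarrow> Poly_Mapping.keys z \<subseteq> C \<and>
     (\<exists>d F G. form d F \<and> form d G \<and>
        (\<exists>p\<in>C. \<forall>v\<in>p. F v \<noteq> 0) \<and> (\<exists>p\<in>C. \<forall>v\<in>p. G v \<noteq> 0) \<and>
        (\<forall>p\<in>C. Poly_Mapping.lookup z p =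
           of_nat (the_enat (local_length C p (local_eqs C p d F))) -
           of_nat (the_enat (local_length C p (local_eqs C p d G)))))"

text \<open>The cycles rationally equivalent to zero: the rational subspace spanned by the cycles
  \<open>f\<^sub>* (div \<phi>)\<close>, where \<open>f\<close> is a morphism from a smooth projective curve \<open>C\<close> to \<open>X\<close> and \<open>\<phi>\<close> is a nonzero
  rational function on \<open>C\<close>. The normalizations \<open>f\<close> of the curves in \<open>X\<close> are among these morphisms;
  the others do not enlarge the span, since rational equivalence is preserved by proper
  pushforward.\<close>

inductive_set rationally_trivial :: "point set \<Rightarrow> cycle0 set" for X :: "point set" where
  zero: "0 \<in> rationally_trivial X"
| divisor: "smooth_curve C \<Longrightarrow> morphism C X f \<Longrightarrow> is_principal C z \<Longrightarrow>
     pushforward f z \<in> rationally_trivial X"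
| add: "z \<in> rationally_trivial X \<Longrightarrow> w \<in> rationally_trivial X \<Longrightarrow> z + w \<in> rationally_trivial X"
| scale: "z \<in> rationally_trivial X \<Longrightarrow> scale c z \<in> rationally_trivial X"

definition cycle_class :: "point set \<Rightarrow> cycle0 \<Rightarrow> cycle0 set" where
  "cycle_class X z = {w. Poly_Mapping.keys w \<subseteq> X \<and> w - z \<in> rationally_trivial X}"


section \<open>Abelian varieties and the Pontryagin product\<close>

definition sum_map :: "point monoid \<Rightarrow> point \<Rightarrow> point" where
  "sum_map A r = pr1 (carrier A) (carrier A) r \<otimes>\<^bsub>A\<^esub> pr2 (carrier A) (carrier A) r"

text \<open>The group law is written multiplicatively, following the library: \<open>x \<otimes>\<^bsub>A\<^esub> y\<close> is the sum
  of \<open>x\<close> and \<open>y\<close> on \<open>A\<close>, and \<open>\<one>\<^bsub>A\<^esub>\<close> is the origin. Smoothness is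
  automatic for a group variety in characteristic zero.\<close>

definition abelian_variety :: "point monoid \<Rightarrow> bool" where
  "abelian_variety A \<longleftrightarrow> comm_group A \<and> variety (carrier A) \<and>
     morphism (carrier A \<times>\<^sub>v carrier A) (carrier A) (sum_map A) \<and>
     morphism (carrier A) (carrier A) (\<lambda>x. inv\<^bsub>A\<^esub> x)"

text \<open>Cycles of arbitrary dimension are formal combinations of subvarieties. The pullback below is
  meant for a projection \<open>f\<close> of a product, whose scheme-theoretic fibres are varieties.\<close>

definition pullback :: "point set \<Rightarrow> (point \<Rightarrow> point) \<Rightarrow> cycle0 \<Rightarrow> (point set \<Rightarrow>\<^sub>0 rat)" where
  "pullback X f z = (\<Sum>x\<in>Poly_Mapping.keys z.
     Poly_Mapping.single {r \<in> X. f r = x} (Poly_Mapping.lookup z x))"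

text \<open>The intersection product on \<open>X\<close> of cycles whose components meet pairwise in finite sets and with
  complementary dimensions. The intersection multiplicity of \<open>V\<close> and \<open>W\<close> at \<open>p\<close> is the length of
  \<open>O / (I\<^sub>V + I\<^sub>W)\<close>, where \<open>O\<close> is the local ring of \<open>X\<close> at \<open>p\<close>: this is the correct multiplicity if \<open>X\<close>
  is smooth and \<open>V\<close> and \<open>W\<close> are Cohen-Macaulay at \<open>p\<close>. Below, \<open>V\<close> and \<open>W\<close> are fibres of the two
  projections from \<open>A \<times> A\<close>, hence smooth.\<close>

definition intersection :: "point set \<Rightarrow> (point set \<Rightarrow>\<^sub>0 rat) \<Rightarrow> (point set \<Rightarrow>\<^sub>0 rat) \<Rightarrow> cycle0" where
  "intersection X \<alpha> \<beta> =
     (\<Sum>V\<in>Poly_Mapping.keys \<alpha>. \<Sum>W\<in>Poly_Mapping.keys \<beta>. \<Sum>p\<in>V \<inter> W.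
        Poly_Mapping.single p (Poly_Mapping.lookup \<alpha> V * Poly_Mapping.lookup \<beta> W *
          of_nat (the_enat (local_length X p (vanishing_at X p V \<union> vanishing_at X p W)))))"

definition pontryagin :: "point monoid \<Rightarrow> cycle0 \<Rightarrow> cycle0 \<Rightarrow> cycle0" where
  "pontryagin A z w = (let X = carrier A; XX = X \<times>\<^sub>v X in
     pushforward (sum_map A)
       (intersection XX (pullback XX (pr1 X X) z) (pullback XX (pr2 X X) w)))"

text \<open>The Chow group of zero-cycles of \<open>A\<close> with rational coefficients, as a ring under the Pontryagin
  product. The operations on classes are induced by those on representatives.\<close>

definition chow0 :: "point monoid \<Rightarrow> cycle0 set ring" where
  "chow0 A = \<lparr>carrier = {cycle_class (carrier A) z |z. Poly_Mapping.keys z \<subseteq> carrier A},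
     mult = (\<lambda>\<alpha> \<beta>. \<Union>z\<in>\<alpha>. \<Union>w\<in>\<beta>. cycle_class (carrier A) (pontryagin A z w)),
     one = cycle_class (carrier A) (pt \<one>\<^bsub>A\<^esub>),
     zero = cycle_class (carrier A) 0,
     add = (\<lambda>\<alpha> \<beta>. \<Union>z\<in>\<alpha>. \<Union>w\<in>\<beta>. cycle_class (carrier A) (z + w))\<rparr>"

end

theory Submission
  imports Defs "HOL-Computational_Algebra.Polynomial"
begin

text \<open>
  The Pontryagin product satisfies \<open>{x} * {y} = {x + y}\<close>, so \<open>CH\<^sub>0(A)\<close> is a quotient of the rational
  group algebra of \<open>A\<close>. Put \<open>u\<^sub>i = {x\<^sub>i}\<close>. The hypothesis says that \<open>u\<^sub>1 + \<dots> + u\<^sub>k = k\<close> in this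
  commutative ring. Rational equivalence is preserved by pushforward along multiplication by \<open>m\<close> on
  \<open>A\<close>, which sends \<open>{x}\<close> to \<open>{m x} = {x}\<^sup>m\<close>; hence all the power sums \<open>u\<^sub>1\<^sup>m + \<dots> + u\<^sub>k\<^sup>m\<close> are equal
  to \<open>k\<close>, and then all the power sums of the \<open>u\<^sub>i - 1\<close> of positive exponent vanish. As the coefficients
  are rational, Newton's identities show that all the elementary symmetric functions of
  positive degree of the \<open>u\<^sub>i - 1\<close> vanish as well. Each \<open>u\<^sub>i - 1\<close> is a root of \<open>\<Prod>\<^sub>j (T - (u\<^sub>j - 1)) = T\<^sup>k\<close>, that is,
  \<open>(u\<^sub>i - 1)\<^sup>k = 0\<close>.

  The algebraic part is \<open>power_sums_criterion_unipotent\<close>. It speaks of an ideal in an integral domain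
  rather than of a quotient ring: the domain is the polynomial ring over the rationals in
  indeterminates that stand for the \<open>x\<^sub>i\<close>, and the ideal consists of the polynomials whose value at the \<open>x\<^sub>i\<close> in
  the group algebra of \<open>A\<close> is rationally equivalent to zero.

  Two geometric facts carry the rest. Composition with a morphism maps test curves to test curves
  (\<open>rationally_trivial_pushforward\<close>), which gives the invariance under multiplication by \<open>m\<close> and,
  through translations, makes the cycles rationally equivalent to zero an ideal of the group algebra.
  And the fibres \<open>{x} \<times> A\<close> and \<open>A \<times> {y}\<close> meet with multiplicity one (\<open>local_length_fibres\<close>), which
  identifies the Pontryagin product with the multiplication of the group algebra
  (\<open>pontryagin_eq_convolution\<close>): a function \<open>f\<close> that vanishes at \<open>(x, y)\<close> is the sum of
  \<open>f(a, b) - f(x, b)\<close>, which vanishes on \<open>{x} \<times> A\<close>, and of \<open>f(x, b)\<close>, which vanishes on \<open>A \<times> {y}\<close>, so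
  the ideals of the two fibres together generate the maximal ideal.
\<close>

section \<open>Linear extension of maps to cycles\<close>

lemma lookup_scale: "Poly_Mapping.lookup (scale c z) x = c * Poly_Mapping.lookup z x"
  by (cases "Poly_Mapping.lookup z x = 0")
    (auto simp: scale_def Poly_Mapping.map.rep_eq when_def)

lemma scale_simps [simp]:
  "scale 0 z = 0" "scale 1 z = z" "scale c 0 = 0"
  "scale c (scale d z) = scale (c * d) z"
  by (rule poly_mapping_eqI; simp add: lookup_scale)+

lemma scale_pt: "scale c (pt x) = Poly_Mapping.single x c"
  by (rule poly_mapping_eqI) (simp add: lookup_scale pt_def lookup_single when_def)

lemma scale_add_left: "scale (c + d) z = scale c z + scale d z"
  by (rule poly_mapping_eqI) (simp add: lookup_scale lookup_add algebra_simps)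

lemma scale_add_right: "scale c (z + w) = scale c z + scale c w"
  by (rule poly_mapping_eqI) (simp add: lookup_scale lookup_add algebra_simps)

lemma scale_sum: "scale c (\<Sum>i\<in>I. f i) = (\<Sum>i\<in>I. scale c (f i))"
  by (induction I rule: infinite_finite_induct) (simp_all add: scale_add_right)

lemma keys_scale_subset: "Poly_Mapping.keys (scale c z) \<subseteq> Poly_Mapping.keys z"
  by (auto simp: in_keys_iff lookup_scale)

text \<open>Pushforward, the Pontryagin product and the evaluation of polynomials below are all linear, or
  bilinear, extensions of maps on points; the rules for \<open>extend\<close> treat them uniformly.\<close>

definition extend :: "('a \<Rightarrow> cycle0) \<Rightarrow> ('a \<Rightarrow>\<^sub>0 rat) \<Rightarrow> cycle0" where
  "extend f z = (\<Sum>x\<in>Poly_Mapping.keys z. scale (Poly_Mapping.lookup z x) (f x))"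

lemma extend_eq_sum:
  assumes "finite S" "Poly_Mapping.keys z \<subseteq> S"
  shows "extend f z = (\<Sum>x\<in>S. scale (Poly_Mapping.lookup z x) (f x))"
  unfolding extend_def using assms
  by (intro sum.mono_neutral_left) (auto simp: in_keys_iff)

lemma extend_0 [simp]: "extend f 0 = 0"
  by (simp add: extend_def)

lemma extend_single [simp]: "extend f (Poly_Mapping.single x c) = scale c (f x)"
  by (simp add: extend_eq_sum[of "{x}"])

lemma extend_pt [simp]: "extend f (pt x) = f x"
  by (simp add: pt_def)

lemma extend_add: "extend f (z + w) = extend f z + extend f w"
proof -
  let ?S = "Poly_Mapping.keys z \<union> Poly_Mapping.keys w"
  have "extend f (z + w) = (\<Sum>x\<in>?S. scale (Poly_Mapping.lookup (z + w) x) (f x))"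
    by (rule extend_eq_sum) (simp_all add: Poly_Mapping.keys_add)
  then show ?thesis
    by (simp add: extend_eq_sum[of ?S] lookup_add scale_add_left sum.distrib)
qed

lemma extend_diff: "extend f (z - w) = extend f z - extend f w"
  using extend_add[of f "z - w" w] by simp

lemma extend_sum: "extend f (\<Sum>i\<in>I. z i) = (\<Sum>i\<in>I. extend f (z i))"
  by (induction I rule: infinite_finite_induct) (simp_all add: extend_add)

lemma extend_scale: "extend f (scale c z) = scale c (extend f z)"
  unfolding extend_eq_sum[OF finite_keys keys_scale_subset, of f c z]
  by (simp add: lookup_scale extend_def scale_sum)

lemma extend_extend: "extend f (extend g z) = extend (\<lambda>x. extend f (g x)) z"
  by (simp add: extend_def[of g] extend_sum extend_scale extend_def[of "\<lambda>x. extend f (g x)"])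

lemma extend_swap: "extend (\<lambda>x. extend (f x) w) z = extend (\<lambda>y. extend (\<lambda>x. f x y) z) w"
  unfolding extend_def scale_sum
  by (subst sum.swap) (simp add: mult.commute)

lemma extend_cong:
  "(\<And>x. x \<in> Poly_Mapping.keys z \<Longrightarrow> f x = g x) \<Longrightarrow> extend f z = extend g z"
  by (simp add: extend_def)

lemma keys_extend_subset:
  assumes "\<And>x. x \<in> Poly_Mapping.keys z \<Longrightarrow> Poly_Mapping.keys (f x) \<subseteq> X"
  shows "Poly_Mapping.keys (extend f z) \<subseteq> X"
  using assms unfolding extend_def
  by (intro order_trans[OF keys_sum] UN_least order_trans[OF keys_scale_subset]) auto

lemma keys_pt [simp]: "Poly_Mapping.keys (pt x) = {x}"
  by (simp add: pt_def)

lemma pushforward_eq_extend: "pushforward f = extend (\<lambda>x. pt (f x))"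
  by (rule ext) (simp add: pushforward_def extend_def scale_pt)

section \<open>Unipotence from power sums\<close>

text \<open>Let \<open>P\<^sub>T = \<Prod>\<^sub>j\<^sub>\<in>\<^sub>T (1 + n\<^sub>j X)\<close>, so that the coefficients of \<open>P\<^sub>S\<close> are the elementary symmetric
  functions. The two relations \<open>P\<^sub>S = (1 + n\<^sub>j X) P\<^sub>S\<^sub>-\<^sub>j\<close> and \<open>P\<^sub>S' = \<Sum>\<^sub>j n\<^sub>j P\<^sub>S\<^sub>-\<^sub>j\<close> show, by induction on
  \<open>m\<close>, that modulo \<open>I\<close> the \<open>m\<close>-th coefficient of \<open>P\<^sub>S\<^sub>-\<^sub>j\<close> is \<open>(-n\<^sub>j)\<^sup>m\<close>. As \<open>P\<^sub>S\<^sub>-\<^sub>j\<close> has degree less than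
  the cardinality of \<open>S\<close>, its coefficient with that index is zero.\<close>

lemma power_sums_criterion:
  fixes n :: "'i \<Rightarrow> 'a::idom" and I :: "'a set"
  assumes add: "\<And>a b. a \<in> I \<Longrightarrow> b \<in> I \<Longrightarrow> a + b \<in> I"
    and mult: "\<And>a b. b \<in> I \<Longrightarrow> a * b \<in> I"
    and div: "\<And>a m. m > 0 \<Longrightarrow> of_nat m * a \<in> I \<Longrightarrow> a \<in> I"
    and zero: "0 \<in> I"
    and fin: "finite S"
    and psum: "\<And>m. m > 0 \<Longrightarrow> (\<Sum>i\<in>S. n i ^ m) \<in> I"
    and i: "i \<in> S"
  shows "n i ^ card S \<in> I"
proof -
  have uminus: "- a \<in> I" if "a \<in> I" for a
    using mult[OF that, of "-1"] by simp
  have diff: "a - b \<in> I" if "a \<in> I" "b \<in> I" for a b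
    using add[OF that(1) uminus[OF that(2)]] by simp
  have sum: "(\<Sum>j\<in>T. f j) \<in> I" if "\<And>j. j \<in> T \<Longrightarrow> f j \<in> I" for f :: "'i \<Rightarrow> 'a" and T
    using that by (induction T rule: infinite_finite_induct) (auto intro: zero add)
  define P where "P T = (\<Prod>j\<in>T. [:1, n j:])" for T
  have P_split: "P S = [:1, n j:] * P (S - {j})" if "j \<in> S" for j
    unfolding P_def using fin that by (rule prod.remove)
  have coeff_split: "coeff (P S) (Suc m) = coeff (P (S - {j})) (Suc m) + n j * coeff (P (S - {j})) m"
    if "j \<in> S" for j m
    by (simp add: P_split[OF that])
  have pderiv: "pderiv (P S) = (\<Sum>j\<in>S. P (S - {j}) * [:n j:])"
    unfolding P_def pderiv_prod by (simp add: pderiv_pCons)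
  have newton: "of_nat (Suc m) * coeff (P S) (Suc m) = (\<Sum>j\<in>S. n j * coeff (P (S - {j})) m)" for m
  proof -
    have "of_nat (Suc m) * coeff (P S) (Suc m) = coeff (pderiv (P S)) m"
      by (simp add: coeff_pderiv)
    then show ?thesis
      by (simp add: pderiv coeff_sum)
  qed
  have main: "coeff (P (S - {j})) m - (- n j) ^ m \<in> I" if "j \<in> S" for j m
    using that
  proof (induction m arbitrary: j)
    case 0
    then show ?case
      by (simp add: P_def zero poly_prod flip: poly_0_coeff_0)
  next
    case (Suc m)
    \<comment> \<open>Modulo the ideal, a multiple of a coefficient of \<open>P S\<close> is a power sum up to sign.\<close>
    have "of_nat (Suc m) * coeff (P S) (Suc m)
        = (\<Sum>j\<in>S. n j * (coeff (P (S - {j})) m - (- n j) ^ m)) + (-1) ^ m * (\<Sum>j\<in>S. n j ^ Suc m)"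
      unfolding newton
      by (simp add: right_diff_distrib sum_subtractf sum_distrib_left power_minus[of "n _"] mult_ac)
    also have "\<dots> \<in> I"
      by (intro add sum mult Suc.IH psum) auto
    finally have "coeff (P S) (Suc m) \<in> I"
      by (rule div[rotated]) simp
    moreover have "coeff (P (S - {j})) (Suc m) - (- n j) ^ Suc m
        = coeff (P S) (Suc m) - n j * (coeff (P (S - {j})) m - (- n j) ^ m)"
      by (simp add: coeff_split[OF Suc.prems] algebra_simps)
    ultimately show ?case
      using Suc by (simp add: diff mult)
  qed
  have "degree (P (S - {i})) \<le> (\<Sum>j\<in>S - {i}. degree [:1, n j:])"
    unfolding P_def using fin by (intro degree_prod_sum_le[unfolded o_def]) simp
  also have "\<dots> \<le> (\<Sum>j\<in>S - {i}. 1)"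
    by (intro sum_mono) simp
  also have "\<dots> < card S"
    using fin i card_gt_0_iff[of S] by auto
  finally have "coeff (P (S - {i})) (card S) = 0"
    by (rule coeff_eq_0)
  then have "(- n i) ^ card S \<in> I"
    using uminus[OF main[OF i, of "card S"]] by simp
  then have "(-1) ^ card S * (- n i) ^ card S \<in> I"
    by (rule mult)
  then show ?thesis
    by (simp flip: power_mult_distrib)
qed

text \<open>The power sums of \<open>u\<^sub>i - 1\<close> are integral combinations of differences \<open>p\<^sub>j\<^sub>+\<^sub>1 - p\<^sub>j\<close> of power sums of
  \<open>u\<^sub>i\<close>. The extra factor \<open>u\<^sub>i\<^sup>j\<close> in the induction avoids binomial coefficients.\<close>

lemma power_sums_criterion_unipotent:
  fixes u :: "'i \<Rightarrow> 'a::idom" and I :: "'a set"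
  assumes add: "\<And>a b. a \<in> I \<Longrightarrow> b \<in> I \<Longrightarrow> a + b \<in> I"
    and mult: "\<And>a b. b \<in> I \<Longrightarrow> a * b \<in> I"
    and div: "\<And>a m. m > 0 \<Longrightarrow> of_nat m * a \<in> I \<Longrightarrow> a \<in> I"
    and zero: "0 \<in> I"
    and fin: "finite S"
    and psum: "\<And>m. (\<Sum>i\<in>S. u i ^ m) - of_nat (card S) \<in> I"
    and i: "i \<in> S"
  shows "(u i - 1) ^ card S \<in> I"
proof (rule power_sums_criterion[OF add mult div zero fin _ i])
  have diff: "a - b \<in> I" if "a \<in> I" "b \<in> I" for a b
    using add[OF that(1) mult[OF that(2), of "-1"]] by simp
  have "(\<Sum>i\<in>S. (u i - 1) ^ Suc m * u i ^ j) \<in> I" for m j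
  proof (induction m arbitrary: j)
    case 0
    have "(\<Sum>i\<in>S. (u i - 1) ^ Suc 0 * u i ^ j)
        = ((\<Sum>i\<in>S. u i ^ Suc j) - of_nat (card S)) - ((\<Sum>i\<in>S. u i ^ j) - of_nat (card S))"
      by (simp add: left_diff_distrib sum_subtractf)
    also have "\<dots> \<in> I"
      by (intro diff psum)
    finally show ?case .
  next
    case (Suc m)
    have "(\<Sum>i\<in>S. (u i - 1) ^ Suc (Suc m) * u i ^ j)
        = (\<Sum>i\<in>S. (u i - 1) ^ Suc m * u i ^ Suc j) - (\<Sum>i\<in>S. (u i - 1) ^ Suc m * u i ^ j)"
      unfolding sum_subtractf[symmetric] by (rule sum.cong) (simp_all add: algebra_simps)
    also have "\<dots> \<in> I"
      by (intro diff Suc.IH)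
    finally show ?case .
  qed
  from this[of _ 0] show "(\<Sum>i\<in>S. (u i - 1) ^ m) \<in> I" if "m > 0" for m
    using that by (cases m) simp_all
qed auto

section \<open>Morphisms of projective sets\<close>

lemma mem_proj_point: "v \<in> proj_point v"
  unfolding proj_point_def by (rule CollectI, rule exI[of _ 1]) simp

lemma mem_proj_pointE:
  assumes "w \<in> proj_point v"
  obtains c where "c \<noteq> 0" "w = (\<lambda>i. c * v i)"
  using assms by (auto simp: proj_point_def)

lemma proj_point_scale: "c \<noteq> 0 \<Longrightarrow> proj_point (\<lambda>i. c * v i) = proj_point v"
proof (intro subset_antisym subsetI)
  fix w assume "c \<noteq> 0"
  {
    assume "w \<in> proj_point (\<lambda>i. c * v i)"
    then obtain d where "d \<noteq> 0" "w = (\<lambda>i. d * (c * v i))"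
      by (rule mem_proj_pointE)
    with \<open>c \<noteq> 0\<close> show "w \<in> proj_point v"
      unfolding proj_point_def by (intro CollectI exI[of _ "d * c"]) (simp add: mult.assoc)
  next
    assume "w \<in> proj_point v"
    then obtain d where "d \<noteq> 0" "w = (\<lambda>i. d * v i)"
      by (rule mem_proj_pointE)
    with \<open>c \<noteq> 0\<close> show "w \<in> proj_point (\<lambda>i. c * v i)"
      unfolding proj_point_def by (intro CollectI exI[of _ "d / c"]) simp
  }
qed

text \<open>Subsets of the infinite-dimensional projective space in which all the spaces \<open>proj_space n\<close> are
  nested.\<close>

definition projective :: "point set \<Rightarrow> bool" where
  "projective X \<longleftrightarrow> (\<forall>p\<in>X. \<exists>v. v \<noteq> (\<lambda>_. 0) \<and> p = proj_point v)"

lemma projectiveE: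
  assumes "projective X" "p \<in> X"
  obtains v where "v \<noteq> (\<lambda>_. 0)" "p = proj_point v"
  using assms by (auto simp: projective_def)

lemma variety_projective: "variety X \<Longrightarrow> projective X"
  by (auto simp: variety_def algebraic_set_def projective_def proj_space_def)

lemma proj_point_eq:
  assumes "projective X" "p \<in> X" "v \<in> p"
  shows "p = proj_point v" "v \<noteq> (\<lambda>_. 0)"
proof -
  obtain u where u: "u \<noteq> (\<lambda>_. 0)" "p = proj_point u"
    using assms(1,2) by (rule projectiveE)
  with assms(3) obtain c where c: "c \<noteq> 0" "v = (\<lambda>i. c * u i)"
    by (auto elim: mem_proj_pointE)
  show "p = proj_point v"
    unfolding c(2) u(2) by (rule proj_point_scale[OF c(1), symmetric])
  show "v \<noteq> (\<lambda>_. 0)"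
    using u(1) c by (auto simp: fun_eq_iff)
qed

lemma form_scale: "form d F \<Longrightarrow> F (\<lambda>i. c * v i) = c ^ d * F v"
  by (induction rule: form.induct) (simp_all add: algebra_simps power_add)

lemma form_nonzero_on:
  assumes "projective X" "p \<in> X" "v \<in> p" "w \<in> p" "form d F" "F v \<noteq> 0"
  shows "F w \<noteq> 0"
proof -
  have "w \<in> proj_point v"
    using assms proj_point_eq(1) by blast
  then show ?thesis
    using assms(5,6) by (auto elim!: mem_proj_pointE simp: form_scale)
qed

lemma form_compose:
  assumes "form e G" "\<And>i. form d (F i)"
  shows "form (e * d) (\<lambda>v. G (\<lambda>i. F i v))"
  using assms(1)
proof (induction rule: form.induct)
  case (mult e G e' G')
  then show ?case
    using form.mult by (simp add: algebra_simps)
qed (use assms(2) in \<open>auto intro: form.intros\<close>)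

lemma form_cmult: "form d F \<Longrightarrow> form d (\<lambda>v. c * F v)"
  using form.mult[OF form.const] by simp

lemma morphism_const: "y \<in> Y \<Longrightarrow> projective Y \<Longrightarrow> morphism X Y (\<lambda>_. y)"
  unfolding morphism_def
proof (intro conjI ballI)
  assume "y \<in> Y" "projective Y"
  then obtain v where v: "v \<noteq> (\<lambda>_. 0)" "y = proj_point v"
    by (auto elim: projectiveE)
  fix p
  show "\<exists>d F. (\<forall>i. form d (F i)) \<and> (\<forall>w\<in>p. \<exists>i. F i w \<noteq> 0) \<and>
        (\<forall>q\<in>X. \<forall>w\<in>q. (\<exists>i. F i w \<noteq> 0) \<longrightarrow> y = proj_point (\<lambda>i. F i w))"
  proof (rule exI[of _ 0], rule exI[of _ "\<lambda>i _. v i"], intro conjI allI ballI impI)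
    show "form 0 (\<lambda>_. v i)" for i
      by (rule form.const)
    show "\<exists>i. v i \<noteq> 0"
      using v(1) by auto
  qed (simp add: v(2))
qed auto

lemma morphism_id: "projective X \<Longrightarrow> morphism X X (\<lambda>x. x)"
  unfolding morphism_def
proof (intro conjI ballI)
  assume X: "projective X"
  fix p assume "p \<in> X"
  show "\<exists>d F. (\<forall>i. form d (F i)) \<and> (\<forall>w\<in>p. \<exists>i. F i w \<noteq> 0) \<and>
        (\<forall>q\<in>X. \<forall>w\<in>q. (\<exists>i. F i w \<noteq> 0) \<longrightarrow> q = proj_point (\<lambda>i. F i w))"
  proof (rule exI[of _ 1], rule exI[of _ "\<lambda>i w. w i"], intro conjI allI ballI impI)
    show "form 1 (\<lambda>w. w i)" for i
      by (rule form.coord)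
    show "\<exists>i. w i \<noteq> 0" if "w \<in> p" for w
      using proj_point_eq(2)[OF X \<open>p \<in> X\<close> that] by auto
    show "q = proj_point (\<lambda>i. w i)" if "q \<in> X" "w \<in> q" for q w
      using proj_point_eq(1)[OF X that] by simp
  qed
qed auto

lemma morphismE:
  assumes "morphism X Y f" "p \<in> X"
  obtains d F where "\<forall>i. form d (F i)" "\<forall>v\<in>p. \<exists>i. F i v \<noteq> 0"
    "\<forall>q\<in>X. \<forall>v\<in>q. \<forall>i. F i v \<noteq> 0 \<longrightarrow> f q = proj_point (\<lambda>i. F i v)"
proof -
  obtain d F where "(\<forall>i. form d (F i)) \<and> (\<forall>v\<in>p. \<exists>i. F i v \<noteq> 0) \<and>
      (\<forall>q\<in>X. \<forall>v\<in>q. (\<exists>i. F i v \<noteq> 0) \<longrightarrow> f q = proj_point (\<lambda>i. F i v))"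
    using bspec[OF conjunct2[OF assms(1)[unfolded morphism_def]] assms(2)] by (elim exE)
  then show thesis
    by (intro that[of d F]) simp_all
qed

text \<open>The forms \<open>G j \<circ> F\<close> describe the composite only where the forms \<open>F i\<close> have no common zero, and a
  form \<open>G j\<close> of degree zero does not vanish where they do. Multiplication by one fixed \<open>F i\<close> that is
  nonzero at the given point restricts the formula to the right open set.\<close>

lemma morphism_compose:
  assumes f: "morphism X Y f" and g: "morphism Y Z g" and X: "projective X"
  shows "morphism X Z (\<lambda>x. g (f x))"
  unfolding morphism_def
proof (intro conjI ballI)
  have fY: "f q \<in> Y" if "q \<in> X" for q
    using f that by (auto simp: morphism_def)
  with g show "(\<lambda>x. g (f x)) \<in> X \<rightarrow> Z"
    by (auto simp: morphism_def)
  fix p assume p: "p \<in> X"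
  obtain d F where "\<forall>i. form d (F i)" "\<forall>v\<in>p. \<exists>i. F i v \<noteq> 0"
    "\<forall>q\<in>X. \<forall>v\<in>q. \<forall>i. F i v \<noteq> 0 \<longrightarrow> f q = proj_point (\<lambda>i. F i v)"
    using f p by (rule morphismE)
  note F = this[rule_format]
  obtain e G where "\<forall>j. form e (G j)" "\<forall>v\<in>f p. \<exists>j. G j v \<noteq> 0"
    "\<forall>q\<in>Y. \<forall>v\<in>q. \<forall>j. G j v \<noteq> 0 \<longrightarrow> g q = proj_point (\<lambda>j. G j v)"
    using g fY[OF p] by (rule morphismE)
  note G = this[rule_format]
  obtain v where v: "v \<in> p"
    using projectiveE[OF X p] mem_proj_point by metis
  with F(2) obtain i where i: "F i v \<noteq> 0"
    by blast
  have Fp: "(\<lambda>i. F i w) \<in> f q" if "q \<in> X" "w \<in> q" "F i w \<noteq> 0" for q w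
    using F(3)[OF that] mem_proj_point by metis
  let ?H = "\<lambda>j w. F i w * G j (\<lambda>i. F i w)"
  show "\<exists>d F. (\<forall>i. form d (F i)) \<and> (\<forall>w\<in>p. \<exists>i. F i w \<noteq> 0) \<and>
      (\<forall>q\<in>X. \<forall>w\<in>q. (\<exists>i. F i w \<noteq> 0) \<longrightarrow> g (f q) = proj_point (\<lambda>i. F i w))"
  proof (rule exI[of _ "d + e * d"], rule exI[of _ ?H], intro conjI allI ballI impI)
    show "form (d + e * d) (?H j)" for j
      by (intro form.mult form_compose F(1) G(1))
    fix w assume w: "w \<in> p"
    have "F i w \<noteq> 0"
      using X p v w F(1) i by (rule form_nonzero_on)
    then show "\<exists>j. ?H j w \<noteq> 0"
      using G(2)[OF Fp[OF p w]] by simp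
  next
    fix q w assume q: "q \<in> X" "w \<in> q" "\<exists>j. ?H j w \<noteq> 0"
    then obtain j where j: "F i w \<noteq> 0" "G j (\<lambda>i. F i w) \<noteq> 0"
      by auto
    have "g (f q) = proj_point (\<lambda>j. G j (\<lambda>i. F i w))"
      using fY[OF q(1)] Fp[OF q(1,2) j(1)] j(2) by (rule G(3))
    then show "g (f q) = proj_point (\<lambda>j. ?H j w)"
      by (simp add: proj_point_scale[OF j(1)])
  qed
qed

lemma morphism_cong:
  assumes "morphism X Y f" "\<And>x. x \<in> X \<Longrightarrow> f x = g x"
  shows "morphism X Y g"
  using assms(1) unfolding morphism_def Pi_def by (simp add: assms(2) cong: ball_cong)

text \<open>Homogeneous coordinates of a point of the Segre variety.\<close>

definition tensor :: "(nat \<Rightarrow> complex) \<Rightarrow> (nat \<Rightarrow> complex) \<Rightarrow> nat \<Rightarrow> complex" where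
  "tensor v w = (\<lambda>k. v (fst (prod_decode k)) * w (snd (prod_decode k)))"

lemma tensor_encode [simp]: "tensor v w (prod_encode (i, j)) = v i * w j"
  by (simp add: tensor_def)

lemma segre_proj_point: "segre (proj_point v) (proj_point w) = proj_point (tensor v w)"
proof (intro subset_antisym subsetI)
  fix u
  assume "u \<in> segre (proj_point v) (proj_point w)"
  then obtain c d where "c \<noteq> 0" "d \<noteq> 0" "u = tensor (\<lambda>i. c * v i) (\<lambda>i. d * w i)"
    by (auto simp: segre_def proj_point_def tensor_def)
  then show "u \<in> proj_point (tensor v w)"
    unfolding proj_point_def
    by (intro CollectI exI[of _ "c * d"]) (simp add: tensor_def mult_ac)
next
  fix u
  assume "u \<in> proj_point (tensor v w)"
  then obtain c where "c \<noteq> 0" "u = tensor (\<lambda>i. c * v i) w"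
    by (auto simp: proj_point_def tensor_def mult_ac)
  moreover have "(\<lambda>i. c * v i) \<in> proj_point v"
    using \<open>c \<noteq> 0\<close> by (auto simp: proj_point_def)
  ultimately show "u \<in> segre (proj_point v) (proj_point w)"
    using mem_proj_point[of w] unfolding segre_def tensor_def
    by (intro CollectI exI[of _ "\<lambda>i. c * v i"] exI[of _ w]) simp
qed

text \<open>A rank one matrix determines its two factors up to scalars: a row and a column through a nonzero
  entry recover them.\<close>

lemma proj_point_eq_of_tensor:
  assumes "tensor v w = tensor v' w'" "v \<noteq> (\<lambda>_. 0)" "w \<noteq> (\<lambda>_. 0)"
  shows "proj_point v = proj_point v'" "proj_point w = proj_point w'"
proof -
  have eq: "v i * w j = v' i * w' j" for i j
    using assms(1) by (metis tensor_encode)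
  obtain i j where nz: "v i \<noteq> 0" "w j \<noteq> 0"
    using assms(2,3) by (auto simp: fun_eq_iff)
  then have nz': "v' i \<noteq> 0" "w' j \<noteq> 0"
    using eq[of i j] by auto
  have "v = (\<lambda>l. w' j / w j * v' l)" "w = (\<lambda>l. v' i / v i * w' l)"
    using eq[of _ j] eq[of i] nz by (auto simp: fun_eq_iff field_simps)
  then show "proj_point v = proj_point v'" "proj_point w = proj_point w'"
    using nz nz' by (metis proj_point_scale divide_eq_0_iff)+
qed

lemma segre_inj_on:
  assumes "projective X" "projective Y"
  shows "inj_on (\<lambda>(p, q). segre p q) (X \<times> Y)"
proof (rule inj_onI, clarify)
  fix p q p' q'
  assume mem: "p \<in> X" "q \<in> Y" "p' \<in> X" "q' \<in> Y" and eq: "segre p q = segre p' q'"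
  obtain v where v: "v \<noteq> (\<lambda>_. 0)" "p = proj_point v"
    using assms(1) mem(1) by (rule projectiveE)
  obtain w where w: "w \<noteq> (\<lambda>_. 0)" "q = proj_point w"
    using assms(2) mem(2) by (rule projectiveE)
  have "tensor v w \<in> segre p' q'"
    using eq v w segre_proj_point mem_proj_point by metis
  then obtain v' w' where "tensor v w = tensor v' w'" "v' \<in> p'" "w' \<in> q'"
    by (auto simp: segre_def tensor_def)
  then show "p = p' \<and> q = q'"
    using v w mem assms proj_point_eq(1) proj_point_eq_of_tensor by metis
qed

lemma
  assumes "projective X" "projective Y" "p \<in> X" "q \<in> Y"
  shows pr1_segre [simp]: "pr1 X Y (segre p q) = p" and pr2_segre [simp]: "pr2 X Y (segre p q) = q"
  using inv_into_f_f[OF segre_inj_on[OF assms(1,2)], of "(p, q)"] assms(3,4)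
  by (simp_all add: pr1_def pr2_def)

lemma prod_varE:
  assumes "r \<in> X \<times>\<^sub>v Y"
  obtains p q where "p \<in> X" "q \<in> Y" "r = segre p q"
  using assms by (auto simp: prod_var_def)

lemma segre_mem_prod_var: "p \<in> X \<Longrightarrow> q \<in> Y \<Longrightarrow> segre p q \<in> X \<times>\<^sub>v Y"
  by (auto simp: prod_var_def)

lemma morphism_pair:
  assumes f: "morphism Z X f" and g: "morphism Z Y g"
  shows "morphism Z (X \<times>\<^sub>v Y) (\<lambda>z. segre (f z) (g z))"
  unfolding morphism_def
proof (intro conjI ballI)
  show "(\<lambda>z. segre (f z) (g z)) \<in> Z \<rightarrow> X \<times>\<^sub>v Y"
    using f g by (auto simp: morphism_def intro: segre_mem_prod_var)
  fix p assume p: "p \<in> Z"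
  obtain d F where "\<forall>i. form d (F i)" "\<forall>v\<in>p. \<exists>i. F i v \<noteq> 0"
    "\<forall>q\<in>Z. \<forall>v\<in>q. \<forall>i. F i v \<noteq> 0 \<longrightarrow> f q = proj_point (\<lambda>i. F i v)"
    using f p by (rule morphismE)
  note F = this[rule_format]
  obtain e G where "\<forall>j. form e (G j)" "\<forall>v\<in>p. \<exists>j. G j v \<noteq> 0"
    "\<forall>q\<in>Z. \<forall>v\<in>q. \<forall>j. G j v \<noteq> 0 \<longrightarrow> g q = proj_point (\<lambda>j. G j v)"
    using g p by (rule morphismE)
  note G = this[rule_format]
  let ?H = "\<lambda>k v. F (fst (prod_decode k)) v * G (snd (prod_decode k)) v"
  show "\<exists>d F. (\<forall>i. form d (F i)) \<and> (\<forall>w\<in>p. \<exists>i. F i w \<noteq> 0) \<and>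
      (\<forall>q\<in>Z. \<forall>w\<in>q. (\<exists>i. F i w \<noteq> 0) \<longrightarrow> segre (f q) (g q) = proj_point (\<lambda>i. F i w))"
  proof (rule exI[of _ "d + e"], rule exI[of _ ?H], intro conjI allI ballI impI)
    show "form (d + e) (?H k)" for k
      by (intro form.mult F(1) G(1))
    fix v assume v: "v \<in> p"
    obtain i j where "F i v \<noteq> 0" "G j v \<noteq> 0"
      using F(2)[OF v] G(2)[OF v] by blast
    then show "\<exists>k. ?H k v \<noteq> 0"
      by (intro exI[of _ "prod_encode (i, j)"]) simp
  next
    fix q v assume q: "q \<in> Z" "v \<in> q" "\<exists>k. ?H k v \<noteq> 0"
    then show "segre (f q) (g q) = proj_point (\<lambda>k. ?H k v)"
      using F(3)[OF q(1,2)] G(3)[OF q(1,2)] by (auto simp: segre_proj_point tensor_def)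
  qed
qed

section \<open>The fibres of the two projections of a product meet transversally\<close>

lemma regular_at_const: "regular_at X p (\<lambda>_. c)"
  unfolding regular_at_def
  by (intro exI[of _ "0::nat"] exI[of _ "\<lambda>_. c"] exI[of _ "\<lambda>_. 1"]) (auto intro: form.const)

lemma regular_at_add:
  assumes "regular_at X p f" "regular_at X p g"
  shows "regular_at X p (\<lambda>q. f q + g q)"
proof -
  obtain d F G where F: "form d F" "form d G" "\<forall>v\<in>p. G v \<noteq> 0"
    "\<forall>q\<in>X. \<forall>v\<in>q. G v \<noteq> 0 \<longrightarrow> f q = F v / G v"
    using assms(1) by (auto simp: regular_at_def)
  obtain e H K where H: "form e H" "form e K" "\<forall>v\<in>p. K v \<noteq> 0"
    "\<forall>q\<in>X. \<forall>v\<in>q. K v \<noteq> 0 \<longrightarrow> g q = H v / K v"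
    using assms(2) by (auto simp: regular_at_def)
  have "form (d + e) (\<lambda>v. F v * K v + G v * H v)" "form (d + e) (\<lambda>v. G v * K v)"
    by (intro form.add form.mult F H)+
  then show ?thesis
    unfolding regular_at_def using F(3,4) H(3,4)
    by (intro exI[of _ "d + e"] exI[of _ "\<lambda>v. F v * K v + G v * H v"] exI[of _ "\<lambda>v. G v * K v"])
      (auto simp: field_simps)
qed

lemma regular_at_mult:
  assumes "regular_at X p f" "regular_at X p g"
  shows "regular_at X p (\<lambda>q. f q * g q)"
proof -
  obtain d F G where F: "form d F" "form d G" "\<forall>v\<in>p. G v \<noteq> 0"
    "\<forall>q\<in>X. \<forall>v\<in>q. G v \<noteq> 0 \<longrightarrow> f q = F v / G v"
    using assms(1) by (auto simp: regular_at_def)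
  obtain e H K where H: "form e H" "form e K" "\<forall>v\<in>p. K v \<noteq> 0"
    "\<forall>q\<in>X. \<forall>v\<in>q. K v \<noteq> 0 \<longrightarrow> g q = H v / K v"
    using assms(2) by (auto simp: regular_at_def)
  have "form (d + e) (\<lambda>v. F v * H v)" "form (d + e) (\<lambda>v. G v * K v)"
    by (intro form.mult F H)+
  then show ?thesis
    unfolding regular_at_def using F(3,4) H(3,4)
    by (intro exI[of _ "d + e"] exI[of _ "\<lambda>v. F v * H v"] exI[of _ "\<lambda>v. G v * K v"]) auto
qed

lemma regular_at_uminus: "regular_at X p f \<Longrightarrow> regular_at X p (\<lambda>q. - f q)"
  using regular_at_mult[OF regular_at_const[of X p "-1"]] by simp

lemma regular_at_diff:
  "regular_at X p f \<Longrightarrow> regular_at X p g \<Longrightarrow> regular_at X p (\<lambda>q. f q - g q)"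
  using regular_at_add[OF _ regular_at_uminus, of X p f g] by simp

lemma reg_ring_simps [simp]:
  "carrier (reg_ring X p) = {f. regular_at X p f}"
  "f \<otimes>\<^bsub>reg_ring X p\<^esub> g = (\<lambda>q. f q * g q)"
  "\<one>\<^bsub>reg_ring X p\<^esub> = (\<lambda>_. 1)"
  "\<zero>\<^bsub>reg_ring X p\<^esub> = (\<lambda>_. 0)"
  "f \<oplus>\<^bsub>reg_ring X p\<^esub> g = (\<lambda>q. f q + g q)"
  by (simp_all add: reg_ring_def)

lemma ring_reg_ring: "ring (reg_ring X p)"
proof (intro ringI abelian_groupI monoidI)
  show "\<exists>g\<in>carrier (reg_ring X p). g \<oplus>\<^bsub>reg_ring X p\<^esub> f = \<zero>\<^bsub>reg_ring X p\<^esub>"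
    if "f \<in> carrier (reg_ring X p)" for f
    using that by (intro bexI[of _ "\<lambda>q. - f q"]) (simp_all add: regular_at_uminus)
qed (simp_all add: regular_at_const regular_at_add regular_at_mult algebra_simps)

lemma vanishing_at_self:
  assumes "f \<in> vanishing_at X p V" "p \<in> V" "p \<noteq> {}"
  shows "f p = 0"
proof -
  obtain d G where "form d G \<and> (\<forall>v\<in>p. G v \<noteq> 0) \<and> (\<forall>q\<in>V. \<forall>v\<in>q. G v \<noteq> 0 \<longrightarrow> f q = 0)"
    using conjunct2[OF CollectD[OF assms(1)[unfolded vanishing_at_def]]] by (elim exE)
  with assms(2,3) show ?thesis
    by blast
qed

lemma vanishing_at_regular: "f \<in> vanishing_at X p V \<Longrightarrow> regular_at X p f"
  by (simp add: vanishing_at_def)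

lemma vanishing_atI:
  assumes "regular_at X p f" "\<And>q. q \<in> V \<Longrightarrow> f q = 0"
  shows "f \<in> vanishing_at X p V"
  unfolding vanishing_at_def using assms
  by (intro CollectI conjI exI[of _ "0::nat"] exI[of _ "\<lambda>_. 1"]) (auto intro: form.const)

lemma ideal_maximal_ideal: "ideal {f. regular_at X p f \<and> f p = 0} (reg_ring X p)"
proof -
  interpret ring "reg_ring X p"
    by (rule ring_reg_ring)
  have uminus: "inv\<^bsub>add_monoid (reg_ring X p)\<^esub> f = (\<lambda>q. - f q)" if "regular_at X p f" for f
    using minus_equality[of "\<lambda>q. - f q" f] that unfolding a_inv_def by (simp add: regular_at_uminus)
  show ?thesis
  proof (rule idealI[OF ring_reg_ring])
    show "subgroup {f. regular_at X p f \<and> f p = 0} (add_monoid (reg_ring X p))" (is "subgroup ?m _")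
    proof (rule subgroup.intro)
      fix f assume f: "f \<in> ?m"
      then have "regular_at X p f"
        by simp
      then show "inv\<^bsub>add_monoid (reg_ring X p)\<^esub> f \<in> ?m"
        unfolding uminus[OF \<open>regular_at X p f\<close>] using f by (simp add: regular_at_uminus)
    qed (auto simp: regular_at_const regular_at_add)
  qed (auto simp: regular_at_mult)
qed

text \<open>If \<open>f = F / G\<close> near \<open>p\<close> and \<open>f p \<noteq> 0\<close>, then \<open>1 / f\<close> is regular at \<open>p\<close> and \<open>f * (1 / f)\<close> agrees with
  \<open>1\<close> near \<open>p\<close>. So elements outside of the maximal ideal are units of the local ring.\<close>

lemma ideal_with_unit:
  assumes J: "ideal J (reg_ring X p)" "vanishing_at X p X \<subseteq> J"
    and p: "p \<in> X" "p \<noteq> {}" and f: "f \<in> J" "f p \<noteq> 0"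
  shows "J = {f. regular_at X p f}"
proof -
  interpret ideal J "reg_ring X p"
    by (rule J(1))
  have reg: "regular_at X p f"
    using Icarr[OF f(1)] by simp
  then obtain d F G where F: "form d F" "form d G" "\<forall>v\<in>p. G v \<noteq> 0"
    "\<forall>q\<in>X. \<forall>v\<in>q. G v \<noteq> 0 \<longrightarrow> f q = F v / G v"
    by (auto simp: regular_at_def)
  have Fp: "F v \<noteq> 0" if "v \<in> p" for v
    using F(3,4) p(1) f(2) that by fastforce
  \<comment> \<open>\<open>G\<^sup>2 / (F G)\<close> instead of \<open>G / F\<close>, as \<open>f\<close> is unknown where \<open>G\<close> vanishes.\<close>
  have forms: "form (d + d) (\<lambda>v. G v * G v)" "form (d + d) (\<lambda>v. F v * G v)"
    by (intro form.mult F)+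
  have inv: "regular_at X p (\<lambda>q. 1 / f q)"
    unfolding regular_at_def using F(3,4) Fp forms
    by (intro exI[of _ "d + d"] exI[of _ "\<lambda>v. G v * G v"] exI[of _ "\<lambda>v. F v * G v"]) auto
  define e where "e = (\<lambda>q. f q * (1 / f q))"
  have "(\<lambda>q. 1 - e q) \<in> vanishing_at X p X"
    unfolding vanishing_at_def e_def
  proof (intro CollectI conjI exI[of _ "d + d"] exI[of _ "\<lambda>v. F v * G v"] ballI impI)
    show "regular_at X p (\<lambda>q. 1 - f q * (1 / f q))"
      by (intro regular_at_diff regular_at_mult regular_at_const reg inv)
    show "form (d + d) (\<lambda>v. F v * G v)"
      by (rule forms)
    show "F v * G v \<noteq> 0" if "v \<in> p" for v
      using that F(3) Fp by simp
    show "1 - f q * (1 / f q) = 0" if "q \<in> X" "v \<in> q" "F v * G v \<noteq> 0" for q v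
      using that F(4) by auto
  qed
  with J(2) have "(\<lambda>q. 1 - e q) \<in> J"
    by blast
  moreover have "e \<in> J"
    using I_r_closed[OF f(1), of "\<lambda>q. 1 / f q"] inv unfolding e_def reg_ring_simps by simp
  ultimately have "\<one>\<^bsub>reg_ring X p\<^esub> \<in> J"
    using additive_subgroup.a_closed[OF is_additive_subgroup, of "\<lambda>q. 1 - e q" e] by simp
  then show ?thesis
    using one_imp_carrier by simp
qed

text \<open>The hypotheses say that \<open>S\<close> generates the maximal ideal of the local ring. Then the only ideals to
  be counted are the maximal ideal and the whole ring, and they form a chain of length one.\<close>

lemma local_length_eq_1:
  assumes p: "p \<in> X" "p \<noteq> {}"
    and S: "\<And>f. f \<in> S \<Longrightarrow> regular_at X p f \<and> f p = 0"
    and gen: "\<And>f J. \<lbrakk>ideal J (reg_ring X p); vanishing_at X p X \<subseteq> J; S \<subseteq> J; regular_at X p f; f p = 0\<rbrakk>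
      \<Longrightarrow> f \<in> J"
  shows "local_length X p S = 1"
proof -
  define P where "P J \<longleftrightarrow> ideal J (reg_ring X p) \<and> vanishing_at X p X \<subseteq> J \<and> S \<subseteq> J" for J
  let ?m = "{f. regular_at X p f \<and> f p = 0}" and ?R = "{f. regular_at X p f}"
  have "l \<le> 1" if J: "\<forall>i\<le>l. P (J i)" "\<forall>i<l. J i \<subset> J (Suc i)" for l and J :: "nat \<Rightarrow> _"
  proof (rule ccontr)
    assume l: "\<not> l \<le> 1"
    then have "P (J 0)" "P (J 1)" "P (J 2)" and sub: "J 0 \<subset> J 1" "J 1 \<subset> J 2"
      using J by (auto simp: numeral_2_eq_2)
    then have J: "ideal (J i) (reg_ring X p)" "vanishing_at X p X \<subseteq> J i" "S \<subseteq> J i"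
      if "i \<in> {0, 1, 2}" for i
      using that by (auto simp: P_def)
    have carr: "J i \<subseteq> ?R" if "i \<in> {0, 1, 2}" for i
      using ideal.Icarr[OF J(1)[OF that]] by auto
    obtain f where f: "f \<in> J 1" "f \<notin> J 0"
      using sub by blast
    then have "f p \<noteq> 0"
      using gen[OF J[of 0], of f] carr[of 1] by auto
    then have "J 1 = ?R"
      using ideal_with_unit[OF J(1,2)[of 1] p f(1)] by simp
    then show False
      using sub carr[of 2] by blast
  qed
  then have "chain_length P \<le> 1"
    unfolding chain_length_def by (intro Sup_least) (auto simp: one_enat_def)
  moreover have "1 \<le> chain_length P"
    unfolding chain_length_def
  proof (intro Sup_upper CollectI exI conjI allI impI)
    let ?J = "\<lambda>i::nat. if i = 0 then ?m else ?R"
    show "(1::enat) = enat 1"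
      by (simp add: one_enat_def)
    have "?m \<subseteq> ?R"
      by auto
    moreover have "ideal ?R (reg_ring X p)"
      using ring.oneideal[OF ring_reg_ring] by simp
    moreover have "vanishing_at X p X \<subseteq> ?m"
      using vanishing_at_self vanishing_at_regular p by blast
    ultimately show "P (?J i)" for i
      using S ideal_maximal_ideal by (auto simp: P_def)
    have "?m \<noteq> ?R"
    proof
      assume eq: "?m = ?R"
      have "(\<lambda>_. 1) \<in> ?m"
        unfolding eq by (simp add: regular_at_const)
      then show False
        by simp
    qed
    with \<open>?m \<subseteq> ?R\<close> show "?J i \<subset> ?J (Suc i)" if "i < 1" for i
      using that by simp
  qed
  ultimately show ?thesis
    unfolding local_length_def P_def by (rule antisym)
qed

text \<open>The map \<open>(a, b) \<mapsto> (x, b)\<close> is linear in Segre coordinates: fix coordinates \<open>v0\<close> of \<open>x\<close> with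
  \<open>v0 i \<noteq> 0\<close>, and send \<open>z = v \<otimes> w\<close> to \<open>v i (v0 \<otimes> w)\<close>, whose entries \<open>v0 l * z (i, m)\<close> are linear in \<open>z\<close>.
  This works where \<open>v i \<noteq> 0\<close>; the factor \<open>z (i, j) = v i * w j\<close>, nonzero at \<open>(x, y)\<close>, excludes the other
  points.\<close>

lemma regular_at_slice:
  assumes X: "projective X" and Y: "projective Y" and x: "x \<in> X" and y: "y \<in> Y"
    and f: "regular_at (X \<times>\<^sub>v Y) (segre x y) f"
  shows "regular_at (X \<times>\<^sub>v Y) (segre x y) (\<lambda>r. f (segre x (pr2 X Y r)))"
proof -
  obtain d F G where F: "form d F" "form d G" "\<forall>u\<in>segre x y. G u \<noteq> 0"
    "\<forall>q\<in>X \<times>\<^sub>v Y. \<forall>u\<in>q. G u \<noteq> 0 \<longrightarrow> f q = F u / G u"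
    using f by (auto simp: regular_at_def)
  obtain v0 where v0: "v0 \<noteq> (\<lambda>_. 0)" "x = proj_point v0"
    using X x by (rule projectiveE)
  obtain w0 where w0: "w0 \<noteq> (\<lambda>_. 0)" "y = proj_point w0"
    using Y y by (rule projectiveE)
  obtain i j where ij: "v0 i \<noteq> 0" "w0 j \<noteq> 0"
    using v0(1) w0(1) by (auto simp: fun_eq_iff)
  define slice where "slice z k = v0 (fst (prod_decode k)) * z (prod_encode (i, snd (prod_decode k)))"
    for z :: "nat \<Rightarrow> complex" and k
  let ?L = "\<lambda>z :: nat \<Rightarrow> complex. z (prod_encode (i, j))"
  have slice_form: "form (1 + d) (\<lambda>z. ?L z * H (slice z))" if "form d H" for H
  proof -
    have "form (d * 1) (\<lambda>z. H (\<lambda>k. slice z k))"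
      unfolding slice_def by (intro form_compose that form_cmult form.coord)
    then show ?thesis
      using form.mult[OF form.coord] by simp
  qed
  have slice_mem: "slice (tensor v w) \<in> segre x b" if "w \<in> b" "b \<in> Y" "v i \<noteq> 0" for v w b
  proof -
    have "slice (tensor v w) = (\<lambda>k. v i * tensor v0 w k)"
      by (rule ext) (simp add: slice_def tensor_def)
    moreover have "segre x b = proj_point (tensor v0 w)"
      unfolding v0(2) proj_point_eq(1)[OF Y that(2,1)] by (rule segre_proj_point)
    ultimately show ?thesis
      using that(3) by (auto simp: proj_point_def)
  qed
  show ?thesis
    unfolding regular_at_def
  proof (rule exI[of _ "1 + d"], rule exI[of _ "\<lambda>z. ?L z * F (slice z)"],
      rule exI[of _ "\<lambda>z. ?L z * G (slice z)"], intro conjI ballI impI)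
    fix z assume "z \<in> segre x y"
    then obtain v w where z: "v \<in> x" "w \<in> y" "z = tensor v w"
      by (auto simp: segre_def tensor_def)
    then have "v i \<noteq> 0" "w j \<noteq> 0"
      using ij v0(2) w0(2) by (auto elim!: mem_proj_pointE)
    then show "?L z * G (slice z) \<noteq> 0"
      using slice_mem[OF z(2) y] F(3) z(3) by simp
  next
    fix q z assume "q \<in> X \<times>\<^sub>v Y" and zq: "z \<in> q" and nz: "?L z * G (slice z) \<noteq> 0"
    then obtain a b where q: "a \<in> X" "b \<in> Y" "q = segre a b"
      by (auto elim: prod_varE)
    then obtain v w where z: "v \<in> a" "w \<in> b" "z = tensor v w"
      using zq by (auto simp: segre_def tensor_def)
    have "slice z \<in> segre x b"
      using nz slice_mem[OF z(2) q(2), of v] z(3) by simp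
    then have "f (segre x b) = F (slice z) / G (slice z)"
      using F(4) nz segre_mem_prod_var[OF x q(2)] by simp
    then show "f (segre x (pr2 X Y q)) = (?L z * F (slice z)) / (?L z * G (slice z))"
      using nz X Y q by simp
  qed (intro slice_form F)+
qed

lemma segre_nonempty: "x \<noteq> {} \<Longrightarrow> y \<noteq> {} \<Longrightarrow> segre x y \<noteq> {}"
  by (auto simp: segre_def)

text \<open>The intersection multiplicity of the two fibres through \<open>(x, y)\<close> is one, because their ideals
  generate the maximal ideal: split \<open>f\<close> as \<open>(f(a, b) - f(x, b)) + f(x, b)\<close>.\<close>

lemma local_length_fibres:
  assumes X: "projective X" and Y: "projective Y" and x: "x \<in> X" and y: "y \<in> Y"
  shows "local_length (X \<times>\<^sub>v Y) (segre x y)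
    (vanishing_at (X \<times>\<^sub>v Y) (segre x y) {r \<in> X \<times>\<^sub>v Y. pr1 X Y r = x} \<union>
     vanishing_at (X \<times>\<^sub>v Y) (segre x y) {r \<in> X \<times>\<^sub>v Y. pr2 X Y r = y}) = 1"
    (is "local_length ?XY ?p (?I \<union> ?K) = 1")
proof (rule local_length_eq_1)
  show p: "?p \<in> ?XY"
    using x y by (rule segre_mem_prod_var)
  have "x \<noteq> {}" "y \<noteq> {}"
    using X Y x y mem_proj_point by (metis projectiveE empty_iff)+
  then show p_ne: "?p \<noteq> {}"
    by (rule segre_nonempty)
  let ?V = "{r \<in> ?XY. pr1 X Y r = x}" and ?W = "{r \<in> ?XY. pr2 X Y r = y}"
  show "regular_at ?XY ?p f \<and> f ?p = 0" if "f \<in> ?I \<union> ?K" for f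
    using that
  proof
    assume "f \<in> ?I"
    then show ?thesis
      by (intro conjI vanishing_at_regular[of f _ _ ?V] vanishing_at_self[where V = ?V, OF _ _ p_ne]) (use p X Y x y in auto)
  next
    assume "f \<in> ?K"
    then show ?thesis
      by (intro conjI vanishing_at_regular[of f _ _ ?W] vanishing_at_self[where V = ?W, OF _ _ p_ne]) (use p X Y x y in auto)
  qed
  fix f J
  assume J: "ideal J (reg_ring ?XY ?p)" "?I \<union> ?K \<subseteq> J" and f: "regular_at ?XY ?p f" "f ?p = 0"
  interpret ideal J "reg_ring ?XY ?p"
    by (rule J(1))
  let ?h = "\<lambda>r. f (segre x (pr2 X Y r))"
  have h: "regular_at ?XY ?p ?h"
    by (intro regular_at_slice assms f)
  have "(\<lambda>r. f r - ?h r) \<in> ?I"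
    using f(1) h X Y by (intro vanishing_atI regular_at_diff) (auto elim!: prod_varE)
  moreover have "?h \<in> ?K"
    using f(2) h by (intro vanishing_atI) auto
  ultimately show "f \<in> J"
    using J(2) additive_subgroup.a_closed[OF is_additive_subgroup, of "\<lambda>r. f r - ?h r" ?h] by auto
qed

section \<open>The Pontryagin product as convolution\<close>

lemma rationally_trivial_keys:
  "z \<in> rationally_trivial X \<Longrightarrow> Poly_Mapping.keys z \<subseteq> X"
proof (induction rule: rationally_trivial.induct)
  case (divisor C f z)
  then show ?case
    unfolding pushforward_eq_extend
    by (intro keys_extend_subset) (auto simp: is_principal_def morphism_def)
next
  case (add z w)
  then show ?case
    using Poly_Mapping.keys_add[of z w] by blast
next
  case (scale z c)
  then show ?case
    using keys_scale_subset by blast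
qed simp

lemma rationally_trivial_uminus: "z \<in> rationally_trivial X \<Longrightarrow> - z \<in> rationally_trivial X"
proof -
  assume "z \<in> rationally_trivial X"
  moreover have "scale (-1) z = - z"
    by (rule poly_mapping_eqI) (simp add: lookup_scale)
  ultimately show ?thesis
    using rationally_trivial.scale by metis
qed

lemma rationally_trivial_diff:
  "z \<in> rationally_trivial X \<Longrightarrow> w \<in> rationally_trivial X \<Longrightarrow> z - w \<in> rationally_trivial X"
  using rationally_trivial.add[OF _ rationally_trivial_uminus] by fastforce

lemma rationally_trivial_extend:
  assumes "\<And>x. x \<in> Poly_Mapping.keys z \<Longrightarrow> f x \<in> rationally_trivial X"
  shows "extend f z \<in> rationally_trivial X"
proof -
  have "(\<Sum>x\<in>S. scale (Poly_Mapping.lookup z x) (f x)) \<in> rationally_trivial X"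
    if "S \<subseteq> Poly_Mapping.keys z" for S
    using finite_subset[OF that finite_keys] that
    by (induction S rule: finite_induct) (auto intro: rationally_trivial.intros assms)
  then show ?thesis
    by (simp add: extend_def)
qed

text \<open>If \<open>f\<close> is a morphism from a smooth curve to \<open>X\<close>, then \<open>g \<circ> f\<close> is one to \<open>Y\<close>, and
  \<open>g\<^sub>* (f\<^sub>* (div \<phi>)) = (g \<circ> f)\<^sub>* (div \<phi>)\<close>.\<close>

lemma rationally_trivial_pushforward:
  assumes "z \<in> rationally_trivial X" "morphism X Y g"
  shows "pushforward g z \<in> rationally_trivial Y"
  using assms(1)
proof (induction rule: rationally_trivial.induct)
  case zero
  then show ?case
    by (simp add: pushforward_eq_extend rationally_trivial.zero)
next
  case (divisor C f z)
  have "morphism C Y (\<lambda>x. g (f x))"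
    using divisor assms(2) by (auto intro: morphism_compose variety_projective simp: smooth_curve_def)
  with divisor have "pushforward (\<lambda>x. g (f x)) z \<in> rationally_trivial Y"
    by (intro rationally_trivial.divisor)
  then show ?case
    by (simp add: pushforward_eq_extend extend_extend)
qed (auto simp: pushforward_eq_extend extend_add extend_scale intro: rationally_trivial.intros)

lemma cycle_class_eq:
  assumes "w - z \<in> rationally_trivial X"
  shows "cycle_class X z = cycle_class X w"
proof -
  have "u - z \<in> rationally_trivial X \<longleftrightarrow> u - w \<in> rationally_trivial X" for u
    using rationally_trivial_diff[OF _ assms, of "u - z"]
      rationally_trivial.add[OF _ assms, of "u - w"] by auto
  then show ?thesis
    by (simp add: cycle_class_def)
qed

lemma mem_cycle_class: "Poly_Mapping.keys z \<subseteq> X \<Longrightarrow> z \<in> cycle_class X z"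
  by (simp add: cycle_class_def rationally_trivial.zero)

text \<open>The pullback of a zero-cycle under a projection is such a sum, with \<open>e x\<close> the fibre over \<open>x\<close>.\<close>

lemma sum_of_singles:
  fixes z :: "'a \<Rightarrow>\<^sub>0 'b::comm_monoid_add" and e :: "'a \<Rightarrow> 'c"
  assumes "inj_on e (Poly_Mapping.keys z)"
  defines "w \<equiv> \<Sum>x\<in>Poly_Mapping.keys z. Poly_Mapping.single (e x) (Poly_Mapping.lookup z x)"
  shows lookup_sum_of_singles: "\<And>x. x \<in> Poly_Mapping.keys z \<Longrightarrow> Poly_Mapping.lookup w (e x) = Poly_Mapping.lookup z x"
    and keys_sum_of_singles: "Poly_Mapping.keys w = e ` Poly_Mapping.keys z"
proof -
  show lookup: "Poly_Mapping.lookup w (e x) = Poly_Mapping.lookup z x"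
    if "x \<in> Poly_Mapping.keys z" for x
  proof -
    have "Poly_Mapping.lookup w (e x) = (\<Sum>y\<in>Poly_Mapping.keys z. if y = x then Poly_Mapping.lookup z y else 0)"
      unfolding w_def lookup_sum using assms(1) that
      by (intro sum.cong) (auto simp: lookup_single when_def inj_on_def)
    then show ?thesis
      using that by simp
  qed
  have "Poly_Mapping.keys w \<subseteq> e ` Poly_Mapping.keys z"
    unfolding w_def by (rule order_trans[OF keys_sum]) (auto split: if_splits)
  then show "Poly_Mapping.keys w = e ` Poly_Mapping.keys z"
    using lookup by (auto simp: in_keys_iff)
qed

text \<open>The product of the rational group algebra of \<open>A\<close>.\<close>

definition convolution :: "point monoid \<Rightarrow> cycle0 \<Rightarrow> cycle0 \<Rightarrow> cycle0" where
  "convolution A z w = extend (\<lambda>x. extend (\<lambda>y. pt (x \<otimes>\<^bsub>A\<^esub> y)) w) z"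

lemma convolution_diff_left: "convolution A (z - z') w = convolution A z w - convolution A z' w"
  by (simp add: convolution_def extend_diff)

lemma convolution_diff_right: "convolution A z (w - w') = convolution A z w - convolution A z w'"
  unfolding convolution_def
  by (subst (1 2 3) extend_swap) (simp add: extend_diff)

text \<open>Fibres over distinct points are distinct because the other factor is nonempty, so the components of
  the pullbacks correspond to the points of \<open>z\<close> and \<open>w\<close>. Two fibres meet in one point, with
  multiplicity one.\<close>

lemma intersection_of_pullbacks:
  assumes X: "projective X" and Y: "projective Y"
    and z: "Poly_Mapping.keys z \<subseteq> X" and w: "Poly_Mapping.keys w \<subseteq> Y" and ne: "X \<noteq> {}" "Y \<noteq> {}"
  shows "intersection (X \<times>\<^sub>v Y) (pullback (X \<times>\<^sub>v Y) (pr1 X Y) z) (pullback (X \<times>\<^sub>v Y) (pr2 X Y) w)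
    = extend (\<lambda>x. extend (\<lambda>y. pt (segre x y)) w) z"
proof -
  let ?XY = "X \<times>\<^sub>v Y"
  let ?V = "\<lambda>x. {r \<in> ?XY. pr1 X Y r = x}" and ?W = "\<lambda>y. {r \<in> ?XY. pr2 X Y r = y}"
  have meet: "?V x \<inter> ?W y = {segre x y}" if "x \<in> X" "y \<in> Y" for x y
  proof (intro subset_antisym subsetI)
    fix r assume "r \<in> ?V x \<inter> ?W y"
    then have "r \<in> ?XY" and r: "pr1 X Y r = x" "pr2 X Y r = y"
      by simp_all
    from this(1) obtain a b where "a \<in> X" "b \<in> Y" "r = segre a b"
      by (rule prod_varE)
    with r X Y show "r \<in> {segre x y}"
      by simp
  qed (use X Y that in \<open>simp add: segre_mem_prod_var\<close>)
  have inj_V: "inj_on ?V (Poly_Mapping.keys z)"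
  proof (rule inj_onI)
    fix x x' assume "x \<in> Poly_Mapping.keys z" "x' \<in> Poly_Mapping.keys z" and eq: "?V x = ?V x'"
    obtain y where "y \<in> Y"
      using ne by blast
    then have "segre x y \<in> ?V x"
      using \<open>x \<in> Poly_Mapping.keys z\<close> z X Y by (auto intro: segre_mem_prod_var)
    with eq \<open>y \<in> Y\<close> \<open>x \<in> Poly_Mapping.keys z\<close> z X Y show "x = x'"
      by auto
  qed
  have inj_W: "inj_on ?W (Poly_Mapping.keys w)"
  proof (rule inj_onI)
    fix y y' assume "y \<in> Poly_Mapping.keys w" "y' \<in> Poly_Mapping.keys w" and eq: "?W y = ?W y'"
    obtain x where "x \<in> X"
      using ne by blast
    then have "segre x y \<in> ?W y"
      using \<open>y \<in> Poly_Mapping.keys w\<close> w X Y by (auto intro: segre_mem_prod_var)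
    with eq \<open>x \<in> X\<close> \<open>y \<in> Poly_Mapping.keys w\<close> w X Y show "y = y'"
      by auto
  qed
  have "intersection ?XY (pullback ?XY (pr1 X Y) z) (pullback ?XY (pr2 X Y) w)
    = (\<Sum>x\<in>Poly_Mapping.keys z. \<Sum>y\<in>Poly_Mapping.keys w. \<Sum>p\<in>?V x \<inter> ?W y.
        Poly_Mapping.single p (Poly_Mapping.lookup z x * Poly_Mapping.lookup w y *
          of_nat (the_enat (local_length ?XY p (vanishing_at ?XY p (?V x) \<union> vanishing_at ?XY p (?W y))))))"
    unfolding intersection_def pullback_def keys_sum_of_singles[OF inj_V] keys_sum_of_singles[OF inj_W]
      sum.reindex[OF inj_V] sum.reindex[OF inj_W] o_def
    by (intro sum.cong refl) (simp only: lookup_sum_of_singles[OF inj_V] lookup_sum_of_singles[OF inj_W])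
  also have "\<dots> = (\<Sum>x\<in>Poly_Mapping.keys z. \<Sum>y\<in>Poly_Mapping.keys w.
      Poly_Mapping.single (segre x y) (Poly_Mapping.lookup z x * Poly_Mapping.lookup w y))"
  proof (intro sum.cong refl)
    fix x y assume "x \<in> Poly_Mapping.keys z" "y \<in> Poly_Mapping.keys w"
    then have xy: "x \<in> X" "y \<in> Y"
      using z w by auto
    show "(\<Sum>p\<in>?V x \<inter> ?W y. Poly_Mapping.single p (Poly_Mapping.lookup z x * Poly_Mapping.lookup w y *
        of_nat (the_enat (local_length ?XY p (vanishing_at ?XY p (?V x) \<union> vanishing_at ?XY p (?W y)))))) =
      Poly_Mapping.single (segre x y) (Poly_Mapping.lookup z x * Poly_Mapping.lookup w y)"
      unfolding meet[OF xy] using local_length_fibres[OF X Y xy] by (simp add: one_enat_def)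
  qed
  also have "\<dots> = extend (\<lambda>x. extend (\<lambda>y. pt (segre x y)) w) z"
    by (simp add: extend_def scale_sum flip: scale_pt)
  finally show ?thesis .
qed

context
  fixes A :: "point monoid"
  assumes A: "abelian_variety A"
begin

interpretation comm_group A
  using A by (simp add: abelian_variety_def)

lemma carrier_projective: "projective (carrier A)"
  using A by (simp add: abelian_variety_def variety_projective)

lemma sum_map_segre:
  "x \<in> carrier A \<Longrightarrow> y \<in> carrier A \<Longrightarrow> sum_map A (segre x y) = x \<otimes>\<^bsub>A\<^esub> y"
  by (simp add: sum_map_def carrier_projective)

lemma pontryagin_eq_convolution:
  assumes "Poly_Mapping.keys z \<subseteq> carrier A" "Poly_Mapping.keys w \<subseteq> carrier A"
  shows "pontryagin A z w = convolution A z w"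
proof -
  have "pontryagin A z w = extend (\<lambda>x. extend (\<lambda>y. pt (sum_map A (segre x y))) w) z"
    unfolding pontryagin_def Let_def
    using intersection_of_pullbacks[OF carrier_projective carrier_projective assms] carrier_not_empty
    by (simp add: pushforward_eq_extend extend_extend)
  also have "\<dots> = convolution A z w"
    unfolding convolution_def using assms
    by (intro extend_cong arg_cong[of _ _ pt] sum_map_segre) auto
  finally show ?thesis .
qed

lemma morphism_sum:
  assumes f: "morphism X (carrier A) f" and g: "morphism X (carrier A) g" and X: "projective X"
  shows "morphism X (carrier A) (\<lambda>x. f x \<otimes>\<^bsub>A\<^esub> g x)"
proof -
  have "morphism X (carrier A) (\<lambda>x. sum_map A (segre (f x) (g x)))"
    using A by (intro morphism_compose[OF morphism_pair[OF f g] _ X]) (simp add: abelian_variety_def)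
  then show ?thesis
  proof (rule morphism_cong)
    show "sum_map A (segre (f x) (g x)) = f x \<otimes>\<^bsub>A\<^esub> g x" if "x \<in> X" for x
      using f g that by (intro sum_map_segre) (auto simp: morphism_def)
  qed
qed

lemma morphism_power: "morphism (carrier A) (carrier A) (\<lambda>x. x [^]\<^bsub>A\<^esub> (m::nat))"
  by (induction m)
    (auto intro!: morphism_const morphism_sum morphism_id carrier_projective)

lemma morphism_translation:
  "a \<in> carrier A \<Longrightarrow> morphism (carrier A) (carrier A) (\<lambda>x. a \<otimes>\<^bsub>A\<^esub> x)"
  by (intro morphism_sum morphism_const morphism_id carrier_projective)

text \<open>Convolution with a point is the pushforward along a translation, which is a morphism.\<close>

lemma convolution_rationally_trivial_right:
  assumes "Poly_Mapping.keys z \<subseteq> carrier A" "w \<in> rationally_trivial (carrier A)"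
  shows "convolution A z w \<in> rationally_trivial (carrier A)"
  unfolding convolution_def pushforward_eq_extend[symmetric] using assms
  by (intro rationally_trivial_extend rationally_trivial_pushforward[OF _ morphism_translation]) auto

lemma convolution_commute:
  assumes "Poly_Mapping.keys z \<subseteq> carrier A" "Poly_Mapping.keys w \<subseteq> carrier A"
  shows "convolution A z w = convolution A w z"
  unfolding convolution_def
  by (subst extend_swap) (use assms in \<open>intro extend_cong, auto intro!: arg_cong[of _ _ pt] m_comm\<close>)

text \<open>In \<open>chow0\<close>, a product of classes is the union over all representatives, so its computation from one
  pair of representatives is the statement that convolution respects rational equivalence.\<close>

lemma chow0_mult:
  assumes z: "Poly_Mapping.keys z \<subseteq> carrier A" and w: "Poly_Mapping.keys w \<subseteq> carrier A"
  shows "cycle_class (carrier A) z \<otimes>\<^bsub>chow0 A\<^esub> cycle_class (carrier A) w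
    = cycle_class (carrier A) (convolution A z w)"
proof -
  let ?T = "rationally_trivial (carrier A)"
  have "cycle_class (carrier A) (pontryagin A z' w') = cycle_class (carrier A) (convolution A z w)"
    if z': "z' \<in> cycle_class (carrier A) z" and w': "w' \<in> cycle_class (carrier A) w" for z' w'
  proof (rule cycle_class_eq)
    have k: "Poly_Mapping.keys z' \<subseteq> carrier A" "Poly_Mapping.keys w' \<subseteq> carrier A"
      and "z' - z \<in> ?T" "w' - w \<in> ?T"
      using z' w' by (auto simp: cycle_class_def)
    from this(1,3,4) have "convolution A w (z' - z) + convolution A z' (w' - w) \<in> ?T"
      using w by (intro rationally_trivial.add convolution_rationally_trivial_right)
    also have "convolution A w (z' - z) = convolution A (z' - z) w"
      using \<open>z' - z \<in> ?T\<close> w by (intro convolution_commute[OF w] rationally_trivial_keys)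
    also have "convolution A (z' - z) w + convolution A z' (w' - w)
        = convolution A z' w' - convolution A z w"
      by (simp add: convolution_diff_left convolution_diff_right)
    finally have "- (pontryagin A z' w' - convolution A z w) \<in> ?T"
      unfolding pontryagin_eq_convolution[OF k] by (rule rationally_trivial_uminus)
    then show "convolution A z w - pontryagin A z' w' \<in> ?T"
      by simp
  qed
  moreover have "z \<in> cycle_class (carrier A) z" "w \<in> cycle_class (carrier A) w"
    using z w by (simp_all add: mem_cycle_class)
  ultimately show ?thesis
    unfolding chow0_def monoid.simps by blast
qed

end

section \<open>Cycles as values of polynomials\<close>

lemma poly_mapping_expansion:
  fixes p :: "'a \<Rightarrow>\<^sub>0 'b::comm_monoid_add"
  shows "p = (\<Sum>m\<in>Poly_Mapping.keys p. Poly_Mapping.single m (Poly_Mapping.lookup p m))"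
  by (rule poly_mapping_eqI) (simp add: lookup_sum lookup_single when_def in_keys_iff)

text \<open>Polynomials over the rationals in countably many indeterminates: functions on exponent vectors.
  They stand in for the group algebra of \<open>A\<close>, whose multiplication depends on \<open>A\<close> and hence is not a
  type class operation. Moreover they form an integral domain, whereas nontrivial torsion points give
  zero divisors of the group algebra.\<close>

type_synonym upoly = "(nat \<Rightarrow>\<^sub>0 nat) \<Rightarrow>\<^sub>0 rat"

definition indet :: "nat \<Rightarrow> upoly" where
  "indet i = Poly_Mapping.single (Poly_Mapping.single i 1) 1"

lemma indet_power: "indet i ^ m = Poly_Mapping.single (Poly_Mapping.single i m) 1"
  by (induction m) (simp_all add: indet_def mult_single flip: single_add)

definition monomial :: "point monoid \<Rightarrow> nat set \<Rightarrow> (nat \<Rightarrow> point) \<Rightarrow> (nat \<Rightarrow>\<^sub>0 nat) \<Rightarrow> point" where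
  "monomial A S x m = (\<Otimes>\<^bsub>A\<^esub>i\<in>S. x i [^]\<^bsub>A\<^esub> Poly_Mapping.lookup m i)"

text \<open>The value of a polynomial at the elements \<open>{x i}\<close> of the group algebra of \<open>A\<close>. By
  \<open>cycle_of_mult\<close> this is a ring homomorphism.\<close>

definition cycle_of :: "point monoid \<Rightarrow> nat set \<Rightarrow> (nat \<Rightarrow> point) \<Rightarrow> upoly \<Rightarrow> cycle0" where
  "cycle_of A S x = extend (\<lambda>m. pt (monomial A S x m))"

lemma cycle_of_add: "cycle_of A S x (p + q) = cycle_of A S x p + cycle_of A S x q"
  by (simp add: cycle_of_def extend_add)

lemma cycle_of_diff: "cycle_of A S x (p - q) = cycle_of A S x p - cycle_of A S x q"
  by (simp add: cycle_of_def extend_diff)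

lemma cycle_of_of_nat_mult: "cycle_of A S x (of_nat n * p) = scale (of_nat n) (cycle_of A S x p)"
  by (induction n) (simp_all add: distrib_right cycle_of_add scale_add_left, simp add: cycle_of_def)

context
  fixes A :: "point monoid" and S :: "nat set" and x :: "nat \<Rightarrow> point"
  assumes A: "abelian_variety A" and S: "finite S" and x: "\<And>i. i \<in> S \<Longrightarrow> x i \<in> carrier A"
begin

interpretation comm_group A
  using A by (simp add: abelian_variety_def)

lemma monomial_closed: "monomial A S x m \<in> carrier A"
  unfolding monomial_def using x by (intro finprod_closed) auto

lemma monomial_0: "monomial A S x 0 = \<one>\<^bsub>A\<^esub>"
  by (simp add: monomial_def)

lemma monomial_add: "monomial A S x (m + n) = monomial A S x m \<otimes>\<^bsub>A\<^esub> monomial A S x n"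
proof -
  have "monomial A S x (m + n) = (\<Otimes>\<^bsub>A\<^esub>i\<in>S.
      x i [^]\<^bsub>A\<^esub> Poly_Mapping.lookup m i \<otimes>\<^bsub>A\<^esub> x i [^]\<^bsub>A\<^esub> Poly_Mapping.lookup n i)"
    unfolding monomial_def using x
    by (intro finprod_cong') (simp_all add: lookup_add nat_pow_mult Pi_iff)
  also have "\<dots> = monomial A S x m \<otimes>\<^bsub>A\<^esub> monomial A S x n"
    unfolding monomial_def using x by (intro finprod_multf) (simp_all add: Pi_iff)
  finally show ?thesis .
qed

lemma monomial_single:
  assumes "i \<in> S"
  shows "monomial A S x (Poly_Mapping.single i m) = x i [^]\<^bsub>A\<^esub> m"
proof -
  have "monomial A S x (Poly_Mapping.single i m)
      = (\<Otimes>\<^bsub>A\<^esub>j\<in>S. if i = j then x j [^]\<^bsub>A\<^esub> m else \<one>\<^bsub>A\<^esub>)"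
    unfolding monomial_def using x by (intro finprod_cong') (auto simp: lookup_single when_def)
  also have "\<dots> = x i [^]\<^bsub>A\<^esub> m"
    using assms S x by (intro finprod_singleton) auto
  finally show ?thesis .
qed

lemma cycle_of_1: "cycle_of A S x 1 = pt \<one>\<^bsub>A\<^esub>"
  unfolding cycle_of_def by (subst single_one[symmetric]) (simp add: monomial_0 del: single_one)

lemma cycle_of_indet_power:
  assumes "i \<in> S"
  shows "cycle_of A S x (indet i ^ m) = pt (x i [^]\<^bsub>A\<^esub> m)"
  by (simp add: cycle_of_def indet_power monomial_single[OF assms])

lemma cycle_of_indet: "i \<in> S \<Longrightarrow> cycle_of A S x (indet i) = pt (x i)"
  using cycle_of_indet_power[of i 1] x by simp

lemma keys_cycle_of: "Poly_Mapping.keys (cycle_of A S x p) \<subseteq> carrier A"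
  unfolding cycle_of_def by (intro keys_extend_subset) (simp add: monomial_closed)

lemma cycle_of_mult: "cycle_of A S x (p * q) = convolution A (cycle_of A S x p) (cycle_of A S x q)"
proof -
  let ?e = "monomial A S x"
  have "p * q = (\<Sum>m\<in>Poly_Mapping.keys p. Poly_Mapping.single m (Poly_Mapping.lookup p m)) *
      (\<Sum>n\<in>Poly_Mapping.keys q. Poly_Mapping.single n (Poly_Mapping.lookup q n))"
    by (simp flip: poly_mapping_expansion)
  also have "\<dots> = (\<Sum>m\<in>Poly_Mapping.keys p. \<Sum>n\<in>Poly_Mapping.keys q.
      Poly_Mapping.single (m + n) (Poly_Mapping.lookup p m * Poly_Mapping.lookup q n))"
    by (simp add: sum_product mult_single)
  finally have "cycle_of A S x (p * q) = extend (\<lambda>m. extend (\<lambda>n. pt (?e (m + n))) q) p"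
    unfolding cycle_of_def
    by (simp add: extend_sum extend_def[of _ p] extend_def[of _ q] scale_sum)
  then show ?thesis
    by (simp add: convolution_def cycle_of_def extend_extend monomial_add)
qed

lemma cycle_class_power:
  "cycle_class (carrier A) (cycle_of A S x p) [^]\<^bsub>chow0 A\<^esub> (n::nat) = cycle_class (carrier A) (cycle_of A S x (p ^ n))"
proof (induction n)
  case 0
  then show ?case
    by (simp add: nat_pow_def cycle_of_1, simp add: chow0_def)
next
  case (Suc n)
  have "p ^ Suc n = p ^ n * p"
    by (simp add: mult.commute)
  then have "cycle_class (carrier A) (cycle_of A S x (p ^ Suc n))
      = cycle_class (carrier A) (cycle_of A S x (p ^ n)) \<otimes>\<^bsub>chow0 A\<^esub> cycle_class (carrier A) (cycle_of A S x p)"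
    by (simp only: cycle_of_mult chow0_mult[OF A keys_cycle_of keys_cycle_of])
  then show ?case
    using Suc.IH by (simp add: nat_pow_def)
qed

text \<open>The polynomials \<open>p\<close> for which \<open>cycle_of A S x p\<close> is rationally equivalent to zero form an ideal closed
  under division by positive integers. It contains all \<open>(\<Sum>\<^sub>i X\<^sub>i\<^sup>m) - card S\<close>, since the value of this
  polynomial is the pushforward of the value for \<open>m = 1\<close> along \<open>y \<mapsto> y\<^sup>m\<close>.\<close>

lemma cycle_of_nilpotent:
  assumes sum: "(\<Sum>i\<in>S. pt (x i)) - scale (of_nat (card S)) (pt \<one>\<^bsub>A\<^esub>) \<in> rationally_trivial (carrier A)"
    and i: "i \<in> S"
  shows "cycle_of A S x ((indet i - 1) ^ card S) \<in> rationally_trivial (carrier A)"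
proof -
  let ?T = "rationally_trivial (carrier A)" and ?I = "{p. cycle_of A S x p \<in> rationally_trivial (carrier A)}"
  have "(indet i - 1) ^ card S \<in> ?I"
  proof (rule power_sums_criterion_unipotent[where I = ?I, OF _ _ _ _ S _ i])
    show "a + b \<in> ?I" if "a \<in> ?I" "b \<in> ?I" for a b
      using that by (simp add: cycle_of_add rationally_trivial.add)
    show "a * b \<in> ?I" if "b \<in> ?I" for a b
      using that by (simp add: cycle_of_mult convolution_rationally_trivial_right[OF A keys_cycle_of])
    show "a \<in> ?I" if "m > 0" "of_nat m * a \<in> ?I" for a m
      using that rationally_trivial.scale[of "scale (of_nat m) (cycle_of A S x a)" "carrier A" "1 / of_nat m"]
      by (simp add: cycle_of_of_nat_mult)
    show "0 \<in> ?I"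
      by (simp add: cycle_of_def rationally_trivial.zero)
    show "(\<Sum>i\<in>S. indet i ^ m) - of_nat (card S) \<in> ?I" for m
    proof -
      have "cycle_of A S x ((\<Sum>i\<in>S. indet i ^ m) - of_nat (card S) * 1)
          = (\<Sum>i\<in>S. cycle_of A S x (indet i ^ m)) - scale (of_nat (card S)) (cycle_of A S x 1)"
        unfolding cycle_of_diff cycle_of_of_nat_mult by (simp add: cycle_of_def extend_sum)
      also have "\<dots> = pushforward (\<lambda>y. y [^]\<^bsub>A\<^esub> m)
          ((\<Sum>i\<in>S. pt (x i)) - scale (of_nat (card S)) (pt \<one>\<^bsub>A\<^esub>))"
        by (simp add: pushforward_eq_extend extend_diff extend_sum extend_scale cycle_of_1
            cycle_of_indet_power)
      also have "\<dots> \<in> ?T"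
        by (intro rationally_trivial_pushforward[OF sum] morphism_power A)
      finally show ?thesis
        by simp
    qed
  qed
  then show ?thesis
    by simp
qed

end

theorem proposition0p9:
  fixes A :: "point monoid" and x :: "nat \<Rightarrow> point" and k :: nat
  assumes "abelian_variety A"
    and "k \<ge> 1"
    and "\<And>i. i \<in> {1..k} \<Longrightarrow> x i \<in> carrier A"
    and "cycle_class (carrier A) ((\<Sum>i=1..k. pt (x i)) - scale (of_nat k) (pt \<one>\<^bsub>A\<^esub>)) = \<zero>\<^bsub>chow0 A\<^esub>"
  shows "\<forall>i\<in>{1..k}.
    cycle_class (carrier A) (pt (x i) - pt \<one>\<^bsub>A\<^esub>) [^]\<^bsub>chow0 A\<^esub> k = \<zero>\<^bsub>chow0 A\<^esub>"
proof
  let ?S = "{1..k}" and ?T = "rationally_trivial (carrier A)"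
  let ?z = "(\<Sum>i\<in>?S. pt (x i)) - scale (of_nat k) (pt \<one>\<^bsub>A\<^esub>)"
  have zero: "\<zero>\<^bsub>chow0 A\<^esub> = cycle_class (carrier A) 0"
    by (simp add: chow0_def)
  have cycle: "cycle_of A ?S x (indet j) = pt (x j)" if "j \<in> ?S" for j
    by (intro cycle_of_indet assms that) auto
  have one: "cycle_of A ?S x 1 = pt \<one>\<^bsub>A\<^esub>"
    by (intro cycle_of_1 assms) auto
  have keys: "Poly_Mapping.keys (cycle_of A ?S x p) \<subseteq> carrier A" for p
    by (intro keys_cycle_of assms) auto
  have "?z = cycle_of A ?S x ((\<Sum>i\<in>?S. indet i) - of_nat k * 1)"
    unfolding cycle_of_diff cycle_of_of_nat_mult one
    using cycle by (simp add: cycle_of_def extend_sum)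
  then have "Poly_Mapping.keys ?z \<subseteq> carrier A"
    using keys by simp
  then have "?z \<in> cycle_class (carrier A) 0"
    using assms(4) zero mem_cycle_class by blast
  then have "?z \<in> ?T"
    by (simp add: cycle_class_def)
  fix i assume i: "i \<in> ?S"
  have "cycle_of A ?S x ((indet i - 1) ^ k) \<in> ?T"
    using cycle_of_nilpotent[OF assms(1) finite_atLeastAtMost assms(3) _ i] \<open>?z \<in> ?T\<close> by simp
  then have "cycle_class (carrier A) (cycle_of A ?S x ((indet i - 1) ^ k)) = \<zero>\<^bsub>chow0 A\<^esub>"
    unfolding zero by (intro cycle_class_eq[symmetric]) simp
  moreover have "cycle_of A ?S x (indet i - 1) = pt (x i) - pt \<one>\<^bsub>A\<^esub>"
    unfolding cycle_of_diff cycle[OF i] one ..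
  moreover have "cycle_class (carrier A) (cycle_of A ?S x (indet i - 1)) [^]\<^bsub>chow0 A\<^esub> k
      = cycle_class (carrier A) (cycle_of A ?S x ((indet i - 1) ^ k))"
    by (intro cycle_class_power assms) auto
  ultimately show "cycle_class (carrier A) (pt (x i) - pt \<one>\<^bsub>A\<^esub>) [^]\<^bsub>chow0 A\<^esub> k = \<zero>\<^bsub>chow0 A\<^esub>"
    by simp
qed

end
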